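(* If a rule set $\mathcal{R}$ is restricted prefix-cyclic (RPC), then it never-terminates.
   Context: Setting (restricted disjunctive chase). Rules $\rho$: $\forall \vec w,\vec x.[\beta\to \bigvee_{i=1}^n \exists \vec y_i.\eta_i]$ with frontier $\vec x$, $\mathrm{branching}(\rho)=n$; datalog = $n=1$ without existential variables; skolemization $\mathrm{sk}(\rho)$ replaces $y\in\vec y_i$ by $f^\rho_{i,y}(\vec x)$. Trigger $\lambda=(\rho,\sigma)$: loaded for $F$ if $\mathrm{body}(\rho)\sigma\subseteq F$; obsolete for $F$ if some extension $\sigma'$ of $\sigma$ gives $\mathrm{head}_i(\rho)\sigma'\subseteq F$; $\mathrm{out}_i(\lambda)=\mathrm{head}_i(\mathrm{sk}(\rho))\sigma$; $\mathcal{R}$-triggers use rules of $\mathcal{R}$ and substitutions into terms over $\mathrm{sk}(\mathcal{R})$. Chase trees of $(\mathcal{R},D)$ are rooted at $D$, apply loaded non-obsolete $\mathcal{R}$-triggers (datalog first) with one child per disjunct, leaves satisfy all rules, and fairness holds; $\mathcal{R}$ never-terminates if some KB with $\mathcal{R}$ has no finite chase tree. A head-choice $hc$ picks a disjunct per rule; $\mathrm{out}_{hc}(\lambda)=\mathrm{out}_{hc(\rho)}(\lambda)$. Birth facts: $\mathrm{birth}(c)=\emptyset$; $\mathrm{birth}(f^\psi_{i,v}(\vec s))=\mathrm{out}_i((\psi,\tau))\cup\bigcup_s\mathrm{birth}(s)$ with $\tau$ mapping $\mathrm{frontier}(\psi)$ to $\vec s$; $\mathrm{birth}((\psi,\tau))=\bigcup_{x\in\mathrm{frontier}(\psi)}\mathrm{birth}(\tau(x))$;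 $\mathrm{skel}(\lambda)$ = terms of $\mathrm{birth}(\lambda)$ plus constants assigned to frontier variables. $h^{uc}_\lambda$ maps functional terms $f(\vec t)\notin\mathrm{skel}(\lambda)$ to fresh constants $c_f$ (unique per $f$), terms of $\mathrm{skel}(\lambda)$ and the $c_f$ to themselves, others to a special constant $\star$. $\mathcal{O}(\mathcal{R},hc,\lambda,h)$ is the minimal fact set containing all facts over predicates of $\mathcal{R}$ and constants in $\mathrm{skel}(\lambda)\cup\{\star\}$, including $\mathrm{birth}(\lambda)$, and including $h(\mathrm{out}_{hc}(\lambda'))$ for each $\mathcal{R}$-trigger $\lambda'$ loaded for it with $\mathrm{out}_{hc}(\lambda')\neq\mathrm{out}_{hc}(\lambda)$. $\lambda$ is uc-unblockable for $\mathcal{R}$ and $hc$ if its rule is datalog or it is not obsolete for $\mathcal{O}(\mathcal{R},hc,\lambda,h^{uc}_\lambda)$. The rule-database of $\rho$ is $D_\rho=\mathrm{body}(\rho)\sigma_{uc}$ with $\sigma_{uc}$ mapping each variable $x$ to a fresh constant $c_x$. A term is cyclic if it has a subterm $f(\vec s)$ with $f$ occurring in $\vec s$; it is $\rho$-cyclic if it is of the form $f(\vec s)$ with $f$ a function symbol of $\mathrm{sk}(\rho)$ occurring in $\vec s$. $\mathrm{RPC}(\mathcal{R},hc,\rho)$ is the (least) fact set including $D_\rho$, $\mathrm{out}_{hc}((\rho,\sigma_{uc}))$, and $\mathrm{out}_{hc}(\lambda)$ for every $\mathcal{R}$-trigger $\lambda=(\psi,\tau)$ such that no cyclic term is in the range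 of $\tau$, $\lambda$ is loaded for $\mathrm{RPC}(\mathcal{R},hc,\rho)$, $\lambda$ is uc-unblockable for $\mathcal{R}$ and $hc$, and $\tau$ is injective if $\psi=\rho$. $\mathcal{R}$ is RPC if there are a head-choice $hc$, a (generating) rule $\rho\in\mathcal{R}$, and a $\rho$-cyclic term occurring in $\mathrm{RPC}(\mathcal{R},hc,\rho)$. *)

theory Defs
  imports Main
begin

type_synonym var = nat

datatype pred = Pred (pname: nat) (arity: nat)

text \<open>Atoms over variables occur in rules; atoms over ground terms are facts.
  Substitutions act through \<^term>\<open>map_atom\<close>.\<close>

datatype 'a atom = Atom (pred_of: pred) (args: "'a list")

definition wf_atom :: "'a atom \<Rightarrow> bool" where
  "wf_atom A \<longleftrightarrow> length (args A) = arity (pred_of A)"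

definition atom_vars :: "var atom list \<Rightarrow> var set" where
  "atom_vars As = (\<Union>A\<in>set As. set (args A))"

text \<open>The quantifier prefix is implicit: variables of the body are universally quantified,
  those of the \<open>i\<close>-th disjunct that are not in the body are existentially quantified in
  that disjunct. Disjuncts are indexed from 0.\<close>

datatype rule = Rule (body: "var atom list") (heads: "var atom list list")

definition branching :: "rule \<Rightarrow> nat" where
  "branching \<rho> = length (heads \<rho>)"

definition head :: "nat \<Rightarrow> rule \<Rightarrow> var atom list" where
  "head i \<rho> = heads \<rho> ! i"

definition univ_vars :: "rule \<Rightarrow> var set" where
  "univ_vars \<rho> = atom_vars (body \<rho>)"

definition exist_vars :: "nat \<Rightarrow> rule \<Rightarrow> var set" where
  "exist_vars i \<rho> = atom_vars (head i \<rho>) - univ_vars \<rho>"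

text \<open>A list, since it provides the argument tuple of the Skolem functions.\<close>

definition frontier :: "rule \<Rightarrow> var list" where
  "frontier \<rho> = sorted_list_of_set
     (univ_vars \<rho> \<inter> (\<Union>i<branching \<rho>. atom_vars (head i \<rho>)))"

definition wf_rule :: "rule \<Rightarrow> bool" where
  "wf_rule \<rho> \<longleftrightarrow> branching \<rho> \<ge> 1 \<and>
     (\<forall>A\<in>set (body \<rho>). wf_atom A) \<and> (\<forall>H\<in>set (heads \<rho>). \<forall>A\<in>set H. wf_atom A)"

definition generating :: "rule \<Rightarrow> bool" where
  "generating \<rho> \<longleftrightarrow> (\<exists>i<branching \<rho>. exist_vars i \<rho> \<noteq> {})"

definition datalog :: "rule \<Rightarrow> bool" where
  "datalog \<rho> \<longleftrightarrow> branching \<rho> = 1 \<and> exist_vars 0 \<rho> = {}"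

definition rule_preds :: "rule set \<Rightarrow> pred set" where
  "rule_preds R = (\<Union>\<rho>\<in>R. pred_of ` (set (body \<rho>) \<union> (\<Union>H\<in>set (heads \<rho>). set H)))"

text \<open>\<open>FSym \<rho> i y\<close> is the Skolem function symbol for the existential variable \<open>y\<close> of the
  \<open>i\<close>-th disjunct of \<open>\<rho>\<close>.\<close>

datatype fsym = FSym rule nat var

text \<open>Besides the ordinary constants \<open>Name n\<close> there are the reserved constants \<open>CVar x\<close>
  (for \<open>c\<^sub>x\<close>), \<open>CFun f\<close> (for \<open>c\<^sub>f\<close>) and \<open>Star\<close>. All kinds are disjoint by construction,
  which provides the required freshness: only constants \<open>CVar x\<close> occur in the facts
  derived from a rule-database, so \<open>CFun f\<close> and \<open>Star\<close> are fresh for the triggers over them.\<close>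

datatype const = Name nat | CVar var | CFun fsym | Star

text \<open>Ground terms.\<close>

datatype trm = Const const | Fun fsym "trm list"

type_synonym fact = "trm atom"

fun subterms :: "trm \<Rightarrow> trm set" where
  "subterms (Const c) = {Const c}"
| "subterms (Fun f ts) = insert (Fun f ts) (\<Union>t\<in>set ts. subterms t)"

definition occurs :: "fsym \<Rightarrow> trm \<Rightarrow> bool" where
  "occurs f t \<longleftrightarrow> (\<exists>ss. Fun f ss \<in> subterms t)"

definition terms_of :: "fact set \<Rightarrow> trm set" where
  "terms_of F = (\<Union>A\<in>F. \<Union>t\<in>set (args A). subterms t)"

definition is_const :: "trm \<Rightarrow> bool" where
  "is_const t \<longleftrightarrow> (\<exists>c. t = Const c)"

text \<open>The function symbols of \<open>sk(\<rho>)\<close>, and the terms over \<open>sk(R)\<close>.\<close>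

definition sk_funs :: "rule \<Rightarrow> fsym set" where
  "sk_funs \<rho> = {FSym \<rho> i y | i y. i < branching \<rho> \<and> y \<in> exist_vars i \<rho>}"

inductive_set sk_terms :: "rule set \<Rightarrow> trm set" for R :: "rule set" where
  const: "Const c \<in> sk_terms R"
| func: "\<lbrakk>\<rho> \<in> R; f \<in> sk_funs \<rho>; length ts = length (frontier \<rho>);
    \<forall>t\<in>set ts. t \<in> sk_terms R\<rbrakk> \<Longrightarrow> Fun f ts \<in> sk_terms R"

text \<open>Only the values of a trigger's substitution on the universal variables of its rule are
  relevant.\<close>

type_synonym trigger = "rule \<times> (var \<Rightarrow> trm)"

definition trigger_on :: "rule set \<Rightarrow> trigger \<Rightarrow> bool" where
  "trigger_on R \<kappa> \<longleftrightarrow> fst \<kappa> \<in> R \<and> (\<forall>x\<in>univ_vars (fst \<kappa>). snd \<kappa> x \<in> sk_terms R)"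

definition inst :: "(var \<Rightarrow> trm) \<Rightarrow> var atom list \<Rightarrow> fact set" where
  "inst \<sigma> As = map_atom \<sigma> ` set As"

definition loaded :: "trigger \<Rightarrow> fact set \<Rightarrow> bool" where
  "loaded \<kappa> F \<longleftrightarrow> inst (snd \<kappa>) (body (fst \<kappa>)) \<subseteq> F"

definition obsolete :: "trigger \<Rightarrow> fact set \<Rightarrow> bool" where
  "obsolete \<kappa> F \<longleftrightarrow> (\<exists>\<sigma>'. (\<forall>x\<in>univ_vars (fst \<kappa>). \<sigma>' x = snd \<kappa> x) \<and>
     (\<exists>i<branching (fst \<kappa>). inst \<sigma>' (head i (fst \<kappa>)) \<subseteq> F))"

lemma loaded_mono [mono]:
  "(\<And>A. P A \<longrightarrow> Q A) \<Longrightarrow> loaded \<kappa> {A. P A} \<longrightarrow> loaded \<kappa> {A. Q A}"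
  by (auto simp: loaded_def)

definition sk_subst :: "nat \<Rightarrow> trigger \<Rightarrow> var \<Rightarrow> trm" where
  "sk_subst i \<kappa> v =
     (if v \<in> exist_vars i (fst \<kappa>)
      then Fun (FSym (fst \<kappa>) i v) (map (snd \<kappa>) (frontier (fst \<kappa>)))
      else snd \<kappa> v)"

definition out :: "nat \<Rightarrow> trigger \<Rightarrow> fact set" where
  "out i \<kappa> = inst (sk_subst i \<kappa>) (head i (fst \<kappa>))"

definition satisfies :: "fact set \<Rightarrow> rule \<Rightarrow> bool" where
  "satisfies F \<rho> \<longleftrightarrow> (\<forall>\<sigma>. loaded (\<rho>, \<sigma>) F \<longrightarrow> obsolete (\<rho>, \<sigma>) F)"

definition database :: "fact set \<Rightarrow> bool" where
  "database D \<longleftrightarrow> finite D \<and> (\<forall>A\<in>D. wf_atom A \<and> (\<forall>t\<in>set (args A). is_const t))"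

text \<open>A chase tree is given by its set \<open>V\<close> of vertices and the labelling \<open>fct\<close> of vertices by
  fact sets. Vertices are addresses: the root is \<open>[]\<close> and the child of \<open>v\<close> for the
  \<open>i\<close>-th disjunct is \<open>v @ [i]\<close>. On finite branches fairness is a consequence of
  the condition on leaves, so it is only stated for infinite branches, which are represented
  by the sequence \<open>b\<close> of directions taken.\<close>

definition leaf :: "nat list set \<Rightarrow> nat list \<Rightarrow> bool" where
  "leaf V v \<longleftrightarrow> v \<in> V \<and> (\<forall>i. v @ [i] \<notin> V)"

definition chase_step ::
  "rule set \<Rightarrow> nat list set \<Rightarrow> (nat list \<Rightarrow> fact set) \<Rightarrow> nat list \<Rightarrow> trigger \<Rightarrow> bool" where
  "chase_step R V fct v \<kappa> \<longleftrightarrow>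
     trigger_on R \<kappa> \<and> loaded \<kappa> (fct v) \<and> \<not> obsolete \<kappa> (fct v) \<and>
     (datalog (fst \<kappa>) \<or>
       (\<forall>\<mu>. trigger_on R \<mu> \<and> datalog (fst \<mu>) \<and> loaded \<mu> (fct v) \<longrightarrow> obsolete \<mu> (fct v))) \<and>
     (\<forall>i. v @ [i] \<in> V \<longleftrightarrow> i < branching (fst \<kappa>)) \<and>
     (\<forall>i<branching (fst \<kappa>). fct (v @ [i]) = fct v \<union> out i \<kappa>)"

definition fair :: "rule set \<Rightarrow> nat list set \<Rightarrow> (nat list \<Rightarrow> fact set) \<Rightarrow> bool" where
  "fair R V fct \<longleftrightarrow>
     (\<forall>b :: nat \<Rightarrow> nat. (\<forall>k. map b [0..<k] \<in> V) \<longrightarrow>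
       (\<forall>\<kappa> k. trigger_on R \<kappa> \<and> loaded \<kappa> (fct (map b [0..<k])) \<longrightarrow>
         (\<exists>m. obsolete \<kappa> (fct (map b [0..<m])))))"

definition chase_tree ::
  "rule set \<Rightarrow> fact set \<Rightarrow> nat list set \<Rightarrow> (nat list \<Rightarrow> fact set) \<Rightarrow> bool" where
  "chase_tree R D V fct \<longleftrightarrow>
     [] \<in> V \<and> fct [] = D \<and>
     (\<forall>v i. v @ [i] \<in> V \<longrightarrow> v \<in> V) \<and>
     (\<forall>v. leaf V v \<longrightarrow> (\<forall>\<rho>\<in>R. satisfies (fct v) \<rho>)) \<and>
     (\<forall>v\<in>V. \<not> leaf V v \<longrightarrow> (\<exists>\<kappa>. chase_step R V fct v \<kappa>)) \<and>
     fair R V fct"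

definition never_terminates :: "rule set \<Rightarrow> bool" where
  "never_terminates R \<longleftrightarrow>
     (\<exists>D. database D \<and> \<not> (\<exists>V fct. chase_tree R D V fct \<and> finite V))"

type_synonym head_choice = "rule \<Rightarrow> nat"

definition head_choice_for :: "rule set \<Rightarrow> head_choice \<Rightarrow> bool" where
  "head_choice_for R hc \<longleftrightarrow> (\<forall>\<rho>\<in>R. hc \<rho> < branching \<rho>)"

definition out_hc :: "head_choice \<Rightarrow> trigger \<Rightarrow> fact set" where
  "out_hc hc \<kappa> = out (hc (fst \<kappa>)) \<kappa>"

text \<open>Values of this substitution outside the frontier do not matter below.\<close>

definition frontier_subst :: "rule \<Rightarrow> trm list \<Rightarrow> var \<Rightarrow> trm" where
  "frontier_subst \<rho> ts x = the (map_of (zip (frontier \<rho>) ts) x)"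

fun fsym_out :: "fsym \<Rightarrow> trm list \<Rightarrow> fact set" where
  "fsym_out (FSym \<psi> i v) ts = out i (\<psi>, frontier_subst \<psi> ts)"

fun birth :: "trm \<Rightarrow> fact set" where
  "birth (Const c) = {}"
| "birth (Fun f ts) = fsym_out f ts \<union> (\<Union>t\<in>set ts. birth t)"

definition birth_trigger :: "trigger \<Rightarrow> fact set" where
  "birth_trigger \<kappa> = (\<Union>x\<in>set (frontier (fst \<kappa>)). birth (snd \<kappa> x))"

definition skel :: "trigger \<Rightarrow> trm set" where
  "skel \<kappa> = terms_of (birth_trigger \<kappa>) \<union>
     {t \<in> snd \<kappa> ` set (frontier (fst \<kappa>)). is_const t}"

definition h_uc :: "trigger \<Rightarrow> trm \<Rightarrow> trm" where
  "h_uc \<kappa> t =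
     (if t \<in> skel \<kappa> then t
      else case t of
        Fun f _ \<Rightarrow> Const (CFun f)
      | Const (CFun f) \<Rightarrow> t
      | _ \<Rightarrow> Const Star)"

text \<open>In the last clause \<open>h\<close> is applied to the arguments of facts only, not below function
  symbols.\<close>

inductive_set overapprox ::
  "rule set \<Rightarrow> head_choice \<Rightarrow> trigger \<Rightarrow> (trm \<Rightarrow> trm) \<Rightarrow> fact set"
  for R :: "rule set" and hc :: head_choice and \<kappa> :: trigger and h :: "trm \<Rightarrow> trm" where
  base: "\<lbrakk>p \<in> rule_preds R; length ts = arity p;
    \<forall>t\<in>set ts. t \<in> skel \<kappa> \<and> is_const t \<or> t = Const Star\<rbrakk>
    \<Longrightarrow> Atom p ts \<in> overapprox R hc \<kappa> h"
| birth: "A \<in> birth_trigger \<kappa> \<Longrightarrow> A \<in> overapprox R hc \<kappa> h"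
| step: "\<lbrakk>trigger_on R \<kappa>'; loaded \<kappa>' (overapprox R hc \<kappa> h);
    out_hc hc \<kappa>' \<noteq> out_hc hc \<kappa>; A \<in> out_hc hc \<kappa>'\<rbrakk>
    \<Longrightarrow> map_atom h A \<in> overapprox R hc \<kappa> h"

definition uc_unblockable :: "rule set \<Rightarrow> head_choice \<Rightarrow> trigger \<Rightarrow> bool" where
  "uc_unblockable R hc \<kappa> \<longleftrightarrow>
     datalog (fst \<kappa>) \<or> \<not> obsolete \<kappa> (overapprox R hc \<kappa> (h_uc \<kappa>))"

definition \<sigma>_uc :: "var \<Rightarrow> trm" where
  "\<sigma>_uc x = Const (CVar x)"

definition rule_database :: "rule \<Rightarrow> fact set" where
  "rule_database \<rho> = inst \<sigma>_uc (body \<rho>)"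

definition cyclic :: "trm \<Rightarrow> bool" where
  "cyclic t \<longleftrightarrow> (\<exists>f ss. Fun f ss \<in> subterms t \<and> (\<exists>s\<in>set ss. occurs f s))"

definition rule_cyclic :: "rule \<Rightarrow> trm \<Rightarrow> bool" where
  "rule_cyclic \<rho> t \<longleftrightarrow>
     (\<exists>f ss. t = Fun f ss \<and> f \<in> sk_funs \<rho> \<and> (\<exists>s\<in>set ss. occurs f s))"

inductive_set RPC_facts :: "rule set \<Rightarrow> head_choice \<Rightarrow> rule \<Rightarrow> fact set"
  for R :: "rule set" and hc :: head_choice and \<rho> :: rule where
  db: "A \<in> rule_database \<rho> \<Longrightarrow> A \<in> RPC_facts R hc \<rho>"
| first: "A \<in> out_hc hc (\<rho>, \<sigma>_uc) \<Longrightarrow> A \<in> RPC_facts R hc \<rho>"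
| step: "\<lbrakk>trigger_on R (\<psi>, \<tau>); \<forall>x\<in>univ_vars \<psi>. \<not> cyclic (\<tau> x);
    loaded (\<psi>, \<tau>) (RPC_facts R hc \<rho>); uc_unblockable R hc (\<psi>, \<tau>);
    \<psi> = \<rho> \<longrightarrow> inj_on \<tau> (univ_vars \<psi>); A \<in> out_hc hc (\<psi>, \<tau>)\<rbrakk>
    \<Longrightarrow> A \<in> RPC_facts R hc \<rho>"

definition restricted_prefix_cyclic :: "rule set \<Rightarrow> bool" where
  "restricted_prefix_cyclic R \<longleftrightarrow>
     (\<exists>hc \<rho>. head_choice_for R hc \<and> \<rho> \<in> R \<and> generating \<rho> \<and>
       (\<exists>t\<in>terms_of (RPC_facts R hc \<rho>). rule_cyclic \<rho> t))"

end

theory Submission imports Defs begin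

text \<open>If a fact set \<open>F\<close> is the leaf of a branch that follows the head-choice, then the output of
  every unblockable trigger loaded for \<open>F\<close> is contained in \<open>F\<close>: otherwise \<open>h\<^sup>u\<^sup>c\<close> maps \<open>F\<close> into the
  over-approximation of the trigger, and since the trigger is obsolete for \<open>F\<close>, it would be obsolete
  for the over-approximation.

  A \<open>\<rho>\<close>-cyclic term yields a trigger \<open>(\<rho>, \<tau>)\<close> in the fixpoint RPC with a function term
  in its frontier; take the earliest such trigger. The substitution \<open>g\<close> that maps \<open>c\<^sub>x\<close> to \<open>\<tau>(x)\<close> is
  then injective on the relevant terms and preserves unblockability, since over-approximations can be
  pulled back along \<open>g\<close>. Hence \<open>F\<close> contains \<open>g\<^sup>n\<close>(RPC) for all \<open>n\<close>. Every function term that arises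
  contains all constants \<open>c\<^sub>x\<close> with \<open>x\<close> in the frontier of \<open>\<rho>\<close>, so the terms \<open>g\<^sup>n(c\<^sub>z)\<close> grow
  strictly if \<open>\<tau>(z)\<close> is a function term, and \<open>F\<close> is infinite.\<close>

section \<open>Substitutions, Skolem terms and births\<close>

lemma args_map_atom [simp]: "args (map_atom f A) = map f (args A)"
  by (cases A) simp

lemma pred_of_map_atom [simp]: "pred_of (map_atom f A) = pred_of A"
  by (cases A) simp

lemma map_atom_comp [simp]: "map_atom f (map_atom g A) = map_atom (f \<circ> g) A"
  by (cases A) simp

lemma map_atom_cong_args: "(\<And>a. a \<in> set (args A) \<Longrightarrow> f a = g a) \<Longrightarrow> map_atom f A = map_atom g A"
  by (cases A) simp

lemma map_atom_fixed: "(\<And>a. a \<in> set (args A) \<Longrightarrow> f a = a) \<Longrightarrow> map_atom f A = A"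
  by (cases A) (simp add: map_idI)

lemma map_atom_inst: "map_atom f ` inst \<sigma> As = inst (f \<circ> \<sigma>) As"
  by (auto simp: inst_def image_image)

lemma inst_cong: "(\<And>x. x \<in> atom_vars As \<Longrightarrow> \<sigma> x = \<sigma>' x) \<Longrightarrow> inst \<sigma> As = inst \<sigma>' As"
  unfolding inst_def by (rule image_cong) (auto intro!: map_atom_cong_args simp: atom_vars_def)

lemma finite_inst [simp]: "finite (inst \<sigma> As)"
  by (simp add: inst_def)

lemma finite_atom_vars [simp]: "finite (atom_vars As)"
  by (simp add: atom_vars_def)

lemma set_frontier:
  "set (frontier \<rho>) = univ_vars \<rho> \<inter> (\<Union>i<branching \<rho>. atom_vars (head i \<rho>))"
  by (simp add: frontier_def univ_vars_def)

lemma distinct_frontier: "distinct (frontier \<rho>)"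
  by (simp add: frontier_def)

lemma map_frontier_subst:
  assumes "length ts = length (frontier \<rho>)"
  shows "map (frontier_subst \<rho> ts) (frontier \<rho>) = ts"
  using assms by (intro nth_equalityI)
    (simp_all add: frontier_subst_def map_of_zip_nth distinct_frontier)

lemma head_var_cases:
  assumes "i < branching \<rho>" "x \<in> atom_vars (head i \<rho>)"
  obtains "x \<in> exist_vars i \<rho>" | "x \<in> set (frontier \<rho>)" "x \<notin> exist_vars i \<rho>"
  using assms by (auto simp: exist_vars_def set_frontier)

lemma frontier_subset: "set (frontier \<rho>) \<subseteq> univ_vars \<rho>"
  by (simp add: set_frontier)

lemma datalog_no_exist_vars:
  "datalog \<rho> \<Longrightarrow> i < branching \<rho> \<Longrightarrow> exist_vars i \<rho> = {}"
  by (simp add: datalog_def)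

lemma not_datalog_generating: "generating \<rho> \<Longrightarrow> \<not> datalog \<rho>"
  by (auto simp: generating_def datalog_no_exist_vars)

section \<open>Subterms, term homomorphisms and trigger outputs\<close>

lemma subterms_refl [simp]: "t \<in> subterms t"
  by (cases t) auto

lemma subterms_trans: "s \<in> subterms t \<Longrightarrow> t \<in> subterms u \<Longrightarrow> s \<in> subterms u"
  by (induction u) auto

lemma size_subterms: "s \<in> subterms t \<Longrightarrow> size s \<le> size t"
proof (induction t)
  case (Fun f ts)
  show ?case
  proof (cases "s = Fun f ts")
    case False
    then obtain t where t: "t \<in> set ts" "s \<in> subterms t"
      using Fun.prems by auto
    then have "size s \<le> size t" using Fun.IH by blast
    also have "\<dots> \<le> size_list size ts" using t(1) by (simp add: size_list_estimation')
    finally show ?thesis by simp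
  qed simp
qed simp

lemma size_arg: "t \<in> set ts \<Longrightarrow> size t < size (Fun f ts)"
  using size_list_estimation'[of t ts "size t" size] by simp

lemma terms_of_subterms: "t \<in> terms_of F \<Longrightarrow> s \<in> subterms t \<Longrightarrow> s \<in> terms_of F"
  unfolding terms_of_def using subterms_trans by blast

lemma terms_of_args: "A \<in> F \<Longrightarrow> a \<in> set (args A) \<Longrightarrow> a \<in> terms_of F"
  unfolding terms_of_def by force

text \<open>Such maps act on the constants inside a term. Both \<open>subst \<tau>\<close> and
  \<open>unname\<close> are of this kind, whereas \<open>h_uc\<close> is not.\<close>

definition hom_on_funs :: "(trm \<Rightarrow> trm) \<Rightarrow> bool" where
  "hom_on_funs g \<longleftrightarrow> (\<forall>f ts. g (Fun f ts) = Fun f (map g ts))"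

lemma hom_on_funsD: "hom_on_funs g \<Longrightarrow> g (Fun f ts) = Fun f (map g ts)"
  by (simp add: hom_on_funs_def)

lemma hom_on_funs_funpow: "hom_on_funs g \<Longrightarrow> hom_on_funs (g ^^ n)"
  by (induction n) (auto simp: hom_on_funs_def)

lemma hom_on_funs_subterms:
  "hom_on_funs g \<Longrightarrow> s \<in> subterms t \<Longrightarrow> g s \<in> subterms (g t)"
  by (induction t) (auto simp: hom_on_funs_def)

text \<open>The variables whose values can be read off an output. A Skolem term shows the whole
  frontier; without one, only the variables of the chosen disjunct are visible, while the frontier
  also collects those of the other disjuncts.\<close>

definition out_vars :: "nat \<Rightarrow> rule \<Rightarrow> var set" where
  "out_vars i \<rho> = (if exist_vars i \<rho> = {} then atom_vars (head i \<rho>) else set (frontier \<rho>))"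

lemma out_vars_frontier: "i < branching \<rho> \<Longrightarrow> out_vars i \<rho> \<subseteq> set (frontier \<rho>)"
  by (auto simp: out_vars_def exist_vars_def set_frontier)

lemma out_cong:
  assumes "i < branching \<rho>" "\<And>x. x \<in> out_vars i \<rho> \<Longrightarrow> \<sigma> x = \<sigma>' x"
  shows "out i (\<rho>, \<sigma>) = out i (\<rho>, \<sigma>')"
  unfolding out_def
proof (simp, rule inst_cong)
  fix x assume x: "x \<in> atom_vars (head i \<rho>)"
  show "sk_subst i (\<rho>, \<sigma>) x = sk_subst i (\<rho>, \<sigma>') x"
  proof (cases "exist_vars i \<rho> = {}")
    case True
    with x assms show ?thesis by (simp add: sk_subst_def out_vars_def)
  next
    case False
    then have "\<sigma> z = \<sigma>' z" if "z \<in> set (frontier \<rho>)" for z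
      using that assms by (simp add: out_vars_def)
    with x assms(1) show ?thesis
      by (auto simp: sk_subst_def elim: head_var_cases)
  qed
qed

lemma out_cong_frontier:
  assumes "i < branching \<rho>" "\<And>x. x \<in> set (frontier \<rho>) \<Longrightarrow> \<sigma> x = \<sigma>' x"
  shows "out i (\<rho>, \<sigma>) = out i (\<rho>, \<sigma>')"
  using assms out_vars_frontier by (intro out_cong) auto

lemma out_arg:
  assumes "y \<in> atom_vars (head i \<rho>)"
  shows "\<exists>A\<in>out i (\<rho>, \<sigma>). sk_subst i (\<rho>, \<sigma>) y \<in> set (args A)"
  using assms by (auto simp: out_def inst_def atom_vars_def)

text \<open>Counterpart of \<open>out_cong\<close>: the values that determine an output also occur
  in it. Together they allow conclusions about a substitution from an equality of outputs.\<close>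

lemma out_vars_terms:
  assumes "x \<in> out_vars i \<rho>"
  shows "\<sigma> x \<in> terms_of (out i (\<rho>, \<sigma>))"
proof (cases "exist_vars i \<rho> = {}")
  case True
  then have "sk_subst i (\<rho>, \<sigma>) x = \<sigma> x" by (simp add: sk_subst_def)
  then show ?thesis
    using assms True out_arg[of x i \<rho> \<sigma>] terms_of_args by (auto simp: out_vars_def)
next
  case False
  then obtain y where y: "y \<in> exist_vars i \<rho>" by auto
  then have "Fun (FSym \<rho> i y) (map \<sigma> (frontier \<rho>)) \<in> terms_of (out i (\<rho>, \<sigma>))"
    using out_arg[of y i \<rho> \<sigma>] terms_of_args by (auto simp: sk_subst_def exist_vars_def)
  moreover have "\<sigma> x \<in> subterms (Fun (FSym \<rho> i y) (map \<sigma> (frontier \<rho>)))"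
    using assms False by (auto simp: out_vars_def intro!: bexI[of _ x])
  ultimately show ?thesis by (rule terms_of_subterms)
qed

lemma args_out_cases:
  assumes "A \<in> out i (\<rho>, \<sigma>)" "i < branching \<rho>" "a \<in> set (args A)"
  obtains x where "x \<in> set (frontier \<rho>)" "a = \<sigma> x"
  | y where "y \<in> exist_vars i \<rho>" "a = Fun (FSym \<rho> i y) (map \<sigma> (frontier \<rho>))"
proof -
  obtain x where x: "x \<in> atom_vars (head i \<rho>)" "a = sk_subst i (\<rho>, \<sigma>) x"
    using assms unfolding out_def inst_def atom_vars_def by force
  show thesis
    using assms(2) x(1)
  proof (cases rule: head_var_cases)
    case 1
    then show ?thesis using that(2) x by (simp add: sk_subst_def)
  next
    case 2
    then show ?thesis using that(1) x by (simp add: sk_subst_def)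
  qed
qed

lemma hom_out:
  assumes "hom_on_funs g"
  shows "map_atom g ` out i (\<rho>, \<sigma>) = out i (\<rho>, g \<circ> \<sigma>)"
proof -
  have "g \<circ> sk_subst i (\<rho>, \<sigma>) = sk_subst i (\<rho>, g \<circ> \<sigma>)"
    by (auto simp: sk_subst_def fun_eq_iff hom_on_funsD[OF assms])
  then show ?thesis by (simp add: out_def map_atom_inst)
qed

lemma hom_out_hc: "hom_on_funs g \<Longrightarrow> map_atom g ` out_hc hc (\<rho>, \<sigma>) = out_hc hc (\<rho>, g \<circ> \<sigma>)"
  by (simp add: out_hc_def hom_out)

lemma finite_out_hc [simp]: "finite (out_hc hc \<kappa>)"
  by (simp add: out_hc_def out_def)

lemma loaded_map:
  assumes "loaded (\<rho>, \<sigma>) F" "map_atom f ` F \<subseteq> F'"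
  shows "loaded (\<rho>, f \<circ> \<sigma>) F'"
  using assms by (fastforce simp: loaded_def simp flip: map_atom_inst)

lemma loaded_value:
  assumes "loaded (\<rho>, \<sigma>) F" "x \<in> univ_vars \<rho>"
  obtains A where "A \<in> F" "\<sigma> x \<in> set (args A)"
  using assms by (fastforce simp: loaded_def inst_def univ_vars_def atom_vars_def)

lemma loaded_subset: "loaded \<kappa> F \<Longrightarrow> F \<subseteq> F' \<Longrightarrow> loaded \<kappa> F'"
  by (auto simp: loaded_def)

text \<open>Universal variables outside the frontier do not occur in any disjunct, so agreement on
  the frontier suffices; the existential witnesses are carried along by \<open>f\<close>.\<close>

lemma obsolete_map:
  assumes "obsolete (\<rho>, \<sigma>) F" "map_atom f ` F \<subseteq> F'"
    and "\<And>x. x \<in> set (frontier \<rho>) \<Longrightarrow> f (\<sigma> x) = \<sigma>' x"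
  shows "obsolete (\<rho>, \<sigma>') F'"
proof -
  from assms(1) obtain \<mu> i where \<mu>: "\<forall>x\<in>univ_vars \<rho>. \<mu> x = \<sigma> x"
    and i: "i < branching \<rho>" "inst \<mu> (head i \<rho>) \<subseteq> F"
    by (auto simp: obsolete_def)
  let ?\<mu> = "\<lambda>x. if x \<in> univ_vars \<rho> then \<sigma>' x else f (\<mu> x)"
  have "inst ?\<mu> (head i \<rho>) = inst (f \<circ> \<mu>) (head i \<rho>)"
    using \<mu> i(1) assms(3) by (intro inst_cong) (auto simp: set_frontier intro!: assms(3)[symmetric])
  also have "\<dots> = map_atom f ` inst \<mu> (head i \<rho>)" by (simp add: map_atom_inst)
  finally have "inst ?\<mu> (head i \<rho>) \<subseteq> F'" using i(2) assms(2) by blast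
  with i(1) show ?thesis
    unfolding obsolete_def by (intro exI[of _ ?\<mu>]) auto
qed

section \<open>Skolem terms, birth facts and skeletons\<close>

lemma sk_terms_subterms: "t \<in> sk_terms R \<Longrightarrow> s \<in> subterms t \<Longrightarrow> s \<in> sk_terms R"
  by (induction arbitrary: s rule: sk_terms.induct) (auto intro: sk_terms.intros)

lemma sk_terms_Fun_cases:
  assumes "Fun f ts \<in> sk_terms R"
  obtains \<psi> i y where "f = FSym \<psi> i y" "\<psi> \<in> R" "i < branching \<psi>" "y \<in> exist_vars i \<psi>"
    "length ts = length (frontier \<psi>)" "\<forall>t\<in>set ts. t \<in> sk_terms R"
  using assms by cases (auto simp: sk_funs_def)

lemma map_frontier_sk_terms:
  assumes "\<psi> \<in> R" "i < branching \<psi>" "y \<in> exist_vars i \<psi>"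
    and "\<And>x. x \<in> set (frontier \<psi>) \<Longrightarrow> \<sigma> x \<in> sk_terms R"
  shows "Fun (FSym \<psi> i y) (map \<sigma> (frontier \<psi>)) \<in> sk_terms R"
  using assms by (intro sk_terms.func[of \<psi>]) (auto simp: sk_funs_def)

lemma birth_iff: "A \<in> birth t \<longleftrightarrow> (\<exists>f ts. Fun f ts \<in> subterms t \<and> A \<in> fsym_out f ts)"
  by (induction t) auto

text \<open>A birth fact stems from a trigger that created some function term of \<open>t\<close>.
  Its arguments are frontier values, which are arguments of that term, or Skolem terms of the same
  trigger for a possibly different existential variable.\<close>

lemma birth_args_cases:
  assumes "t \<in> sk_terms R" "A \<in> birth t" "a \<in> set (args A)"
  obtains "a \<in> subterms t" "\<exists>f ts. Fun f ts \<in> subterms t \<and> a \<in> set ts"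
  | \<psi> i y z ts where "a = Fun (FSym \<psi> i z) ts" "Fun (FSym \<psi> i y) ts \<in> subterms t"
      "z \<in> exist_vars i \<psi>"
proof -
  obtain f ts where f: "Fun f ts \<in> subterms t" "A \<in> fsym_out f ts"
    using assms(2) by (auto simp: birth_iff)
  obtain \<psi> i y where y: "f = FSym \<psi> i y" "i < branching \<psi>" "length ts = length (frontier \<psi>)"
    using sk_terms_subterms[OF assms(1) f(1)] by (elim sk_terms_Fun_cases)
  have ts: "map (frontier_subst \<psi> ts) (frontier \<psi>) = ts"
    using y(3) by (rule map_frontier_subst)
  have "A \<in> out i (\<psi>, frontier_subst \<psi> ts)" using f(2) y(1) by simp
  from this y(2) assms(3) show thesis
  proof (cases rule: args_out_cases)
    case (1 x)
    then have "a \<in> set ts" using arg_cong[OF ts, of set] by auto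
    moreover from this have "a \<in> subterms t"
      using f(1) by (intro subterms_trans[of a "Fun f ts" t]) (auto intro!: bexI[of _ a])
    ultimately show ?thesis using f(1) that(1) by blast
  next
    case (2 z)
    then show ?thesis using that(2)[of \<psi> i z ts y] f y ts by simp
  qed
qed

lemma fsym_out_eq_out:
  assumes "i < branching \<psi>"
  shows "fsym_out (FSym \<psi> i y) (map \<sigma> (frontier \<psi>)) = out i (\<psi>, \<sigma>)"
proof -
  have "map (frontier_subst \<psi> (map \<sigma> (frontier \<psi>))) (frontier \<psi>) = map \<sigma> (frontier \<psi>)"
    by (rule map_frontier_subst) simp
  then have "frontier_subst \<psi> (map \<sigma> (frontier \<psi>)) x = \<sigma> x" if "x \<in> set (frontier \<psi>)" for x
    using that by simp
  then show ?thesis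
    unfolding fsym_out.simps by (rule out_cong_frontier[OF assms])
qed

lemma fsym_out_map:
  assumes "hom_on_funs g" "Fun f ts \<in> sk_terms R"
  shows "fsym_out f (map g ts) = map_atom g ` fsym_out f ts"
proof -
  obtain \<psi> i y where y: "f = FSym \<psi> i y" "i < branching \<psi>" "length ts = length (frontier \<psi>)"
    using assms(2) by (elim sk_terms_Fun_cases)
  have "map g ts = map (g \<circ> frontier_subst \<psi> ts) (frontier \<psi>)"
    using map_frontier_subst[OF y(3)] by (metis map_map)
  then show ?thesis
    using y fsym_out_eq_out[of i \<psi> y "g \<circ> frontier_subst \<psi> ts"] by (simp add: hom_out[OF assms(1)])
qed

text \<open>Terms in the birth facts that are not subterms of \<open>t\<close> are siblings of such
  subterms, and siblings have the same \<open>fsym_out\<close> because it ignores the existential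
  variable.\<close>

lemma terms_birth_fsym_out:
  assumes "t \<in> sk_terms R" "Fun f ts \<in> terms_of (birth t)"
  shows "fsym_out f ts \<subseteq> birth t"
proof -
  obtain A a where A: "A \<in> birth t" "a \<in> set (args A)" "Fun f ts \<in> subterms a"
    using assms(2) by (auto simp: terms_of_def)
  from assms(1) A(1,2) show ?thesis
  proof (cases rule: birth_args_cases)
    case 1
    then have "Fun f ts \<in> subterms t" using A(3) subterms_trans by blast
    then show ?thesis unfolding birth_iff subset_iff by blast
  next
    case (2 \<psi> i y z us)
    show ?thesis
    proof (cases "Fun f ts = a")
      case True
      then show ?thesis using 2 by (fastforce simp: birth_iff)
    next
      case False
      then have "Fun f ts \<in> subterms (Fun (FSym \<psi> i y) us)" using 2 A(3) by auto
      then have "Fun f ts \<in> subterms t" using 2(2) by (rule subterms_trans)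
      then show ?thesis unfolding birth_iff subset_iff by blast
    qed
  qed
qed

lemma Fun_in_terms_birth:
  assumes "Fun f ts \<in> sk_terms R"
  shows "Fun f ts \<in> terms_of (birth (Fun f ts))"
proof -
  obtain \<psi> i y where y: "f = FSym \<psi> i y" "y \<in> exist_vars i \<psi>" "length ts = length (frontier \<psi>)"
    using assms by (elim sk_terms_Fun_cases)
  let ?\<sigma> = "frontier_subst \<psi> ts"
  have "\<exists>A\<in>out i (\<psi>, ?\<sigma>). sk_subst i (\<psi>, ?\<sigma>) y \<in> set (args A)"
    using y(2) by (intro out_arg) (auto simp: exist_vars_def)
  then have "Fun f ts \<in> terms_of (fsym_out f ts)"
    using y map_frontier_subst[OF y(3)] terms_of_args by (auto simp: sk_subst_def)
  then show ?thesis by (auto simp: terms_of_def)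
qed

lemma skel_subterms: "t \<in> skel \<kappa> \<Longrightarrow> s \<in> subterms t \<Longrightarrow> s \<in> skel \<kappa>"
  unfolding skel_def is_const_def
  by (elim UnE CollectE conjE exE) (simp_all add: terms_of_subterms)

lemma skel_birth_args: "A \<in> birth_trigger \<kappa> \<Longrightarrow> a \<in> set (args A) \<Longrightarrow> a \<in> skel \<kappa>"
  unfolding skel_def using terms_of_args by blast

lemma frontier_value_skel:
  assumes "x \<in> set (frontier \<psi>)" "\<sigma> x \<in> sk_terms R"
  shows "\<sigma> x \<in> skel (\<psi>, \<sigma>)"
proof (cases "\<sigma> x")
  case (Const c)
  then have "is_const (\<sigma> x)" by (simp add: is_const_def)
  then show ?thesis using assms by (simp add: skel_def)
next
  case (Fun f ts)
  then have "\<sigma> x \<in> terms_of (birth (\<sigma> x))" using assms Fun_in_terms_birth by simp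
  then show ?thesis using assms(1) by (auto simp: skel_def birth_trigger_def terms_of_def)
qed

text \<open>Used to recognise triggers whose entire output is already among the birth facts.\<close>

lemma skel_fsym_out:
  assumes "\<And>x. x \<in> set (frontier \<psi>) \<Longrightarrow> \<sigma> x \<in> sk_terms R" "Fun f ts \<in> skel (\<psi>, \<sigma>)"
  shows "fsym_out f ts \<subseteq> birth_trigger (\<psi>, \<sigma>)"
proof -
  obtain x where "x \<in> set (frontier \<psi>)" "Fun f ts \<in> terms_of (birth (\<sigma> x))"
    using assms(2) by (fastforce simp: skel_def birth_trigger_def terms_of_def is_const_def)
  then show ?thesis
    using terms_birth_fsym_out assms(1) by (fastforce simp: birth_trigger_def)
qed

section \<open>Over-approximations and unblockable triggers\<close>

text \<open>Expresses freshness of \<open>Star\<close> and \<open>CFun f\<close>: a pure value of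
  \<open>h_uc\<close> cannot be one of the constants it introduces, so it was left unchanged
  (\<open>h_uc_pure\<close>).\<close>

definition pure_term :: "trm \<Rightarrow> bool" where
  "pure_term t \<longleftrightarrow> (\<forall>c. Const c \<in> subterms t \<longrightarrow> c \<in> range CVar)"

lemma pure_term_subterms: "pure_term t \<Longrightarrow> s \<in> subterms t \<Longrightarrow> pure_term s"
  unfolding pure_term_def using subterms_trans by blast

lemma pure_term_Const [simp]: "pure_term (Const c) \<longleftrightarrow> c \<in> range CVar"
  by (auto simp: pure_term_def)

lemma pure_term_Fun [simp]: "pure_term (Fun f ts) \<longleftrightarrow> (\<forall>t\<in>set ts. pure_term t)"
  by (auto simp: pure_term_def)

lemma pure_terms_out:
  assumes "\<And>x. x \<in> set (frontier \<psi>) \<Longrightarrow> pure_term (\<sigma> x)" "i < branching \<psi>"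
    and "t \<in> terms_of (out i (\<psi>, \<sigma>))"
  shows "pure_term t"
proof -
  obtain A a where A: "A \<in> out i (\<psi>, \<sigma>)" "a \<in> set (args A)" "t \<in> subterms a"
    using assms(3) by (auto simp: terms_of_def)
  from A(1) assms(2) A(2) have "pure_term a"
    by (cases rule: args_out_cases) (auto simp: assms(1))
  then show ?thesis using A(3) by (rule pure_term_subterms)
qed

lemma h_uc_cases:
  obtains "h_uc \<kappa> t = t" | f where "h_uc \<kappa> t = Const (CFun f)" | "h_uc \<kappa> t = Const Star"
proof -
  have "h_uc \<kappa> t = t \<or> (\<exists>f. h_uc \<kappa> t = Const (CFun f)) \<or> h_uc \<kappa> t = Const Star"
    by (auto simp: h_uc_def split: trm.split const.split)
  then show thesis using that by blast
qed

lemma h_uc_skel: "t \<in> skel \<kappa> \<Longrightarrow> h_uc \<kappa> t = t"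
  by (simp add: h_uc_def)

lemma h_uc_Star [simp]: "h_uc \<kappa> (Const Star) = Const Star"
  by (simp add: h_uc_def)

lemma h_uc_CFun [simp]: "h_uc \<kappa> (Const (CFun f)) = Const (CFun f)"
  by (simp add: h_uc_def)

lemma h_uc_idem [simp]: "h_uc \<kappa> (h_uc \<kappa> t) = h_uc \<kappa> t"
  by (rule h_uc_cases[of \<kappa> t]) auto

lemma h_uc_pure: "pure_term (h_uc \<kappa> t) \<Longrightarrow> h_uc \<kappa> t = t"
  by (rule h_uc_cases[of \<kappa> t]) auto

lemma h_uc_sk_terms: "t \<in> sk_terms R \<Longrightarrow> h_uc \<kappa> t \<in> sk_terms R"
  by (rule h_uc_cases[of \<kappa> t]) (auto intro: sk_terms.const)

text \<open>Base and birth facts use skeleton terms and \<open>Star\<close>, and all other facts are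
  images under the idempotent map \<open>h_uc\<close>.\<close>

lemma overapprox_fixed:
  assumes "A \<in> overapprox R hc \<kappa> (h_uc \<kappa>)" "a \<in> set (args A)"
  shows "h_uc \<kappa> a = a"
  using assms by cases (auto simp: h_uc_skel skel_birth_args)

text \<open>A branch that follows the head-choice, except that obsolete triggers may be applied.\<close>

inductive reach :: "rule set \<Rightarrow> head_choice \<Rightarrow> fact set \<Rightarrow> fact set \<Rightarrow> bool"
  for R :: "rule set" and hc :: head_choice and D :: "fact set" where
  reach_refl: "reach R hc D D"
| reach_step: "\<lbrakk>reach R hc D F; trigger_on R \<kappa>; loaded \<kappa> F\<rbrakk> \<Longrightarrow> reach R hc D (F \<union> out_hc hc \<kappa>)"

lemma reach_finite: "reach R hc D F \<Longrightarrow> finite D \<Longrightarrow> finite F"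
  by (induction rule: reach.induct) auto

lemma rule_preds_body: "\<rho> \<in> R \<Longrightarrow> A \<in> set (body \<rho>) \<Longrightarrow> pred_of A \<in> rule_preds R"
  by (auto simp: rule_preds_def)

lemma rule_preds_head:
  "\<rho> \<in> R \<Longrightarrow> i < branching \<rho> \<Longrightarrow> A \<in> set (head i \<rho>) \<Longrightarrow> pred_of A \<in> rule_preds R"
  unfolding rule_preds_def head_def branching_def by (auto dest: nth_mem)

lemma wf_rule_body: "wf_rule \<rho> \<Longrightarrow> A \<in> set (body \<rho>) \<Longrightarrow> wf_atom A"
  by (auto simp: wf_rule_def)

lemma wf_rule_head: "wf_rule \<rho> \<Longrightarrow> i < branching \<rho> \<Longrightarrow> A \<in> set (head i \<rho>) \<Longrightarrow> wf_atom A"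
  unfolding wf_rule_def head_def branching_def by (auto dest: nth_mem)

lemma overapprox_baseI:
  assumes "pred_of A \<in> rule_preds R" "wf_atom A"
    and "\<And>a. a \<in> set (args A) \<Longrightarrow> a \<in> skel \<kappa> \<and> is_const a \<or> a = Const Star"
  shows "A \<in> overapprox R hc \<kappa> h"
proof -
  have "Atom (pred_of A) (args A) \<in> overapprox R hc \<kappa> h"
    using assms by (intro overapprox.base) (auto simp: wf_atom_def)
  then show ?thesis by simp
qed

lemma wf_atom_map [simp]: "wf_atom (map_atom f A) \<longleftrightarrow> wf_atom A"
  by (simp add: wf_atom_def)
lemma out_wf:
  assumes "wf_rule \<psi>" "\<psi> \<in> R" "i < branching \<psi>" "A \<in> out i (\<psi>, \<sigma>)"
  shows "pred_of A \<in> rule_preds R \<and> wf_atom A"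
  using assms wf_rule_head rule_preds_head by (fastforce simp: out_def inst_def)

text \<open>These are the only terms that unblockable triggers produce from the rule-database: a
  non-datalog trigger with only constants in its frontier is obsolete for its over-approximation,
  so every function term stems from the initial trigger.\<close>

inductive_set seeded :: "rule set \<Rightarrow> head_choice \<Rightarrow> rule \<Rightarrow> trm set"
  for R :: "rule set" and hc :: head_choice and \<rho> :: rule where
  seeded_var: "x \<in> univ_vars \<rho> \<Longrightarrow> \<sigma>_uc x \<in> seeded R hc \<rho>"
| seeded_base: "y \<in> exist_vars (hc \<rho>) \<rho> \<Longrightarrow>
    Fun (FSym \<rho> (hc \<rho>) y) (map \<sigma>_uc (frontier \<rho>)) \<in> seeded R hc \<rho>"
| seeded_func: "\<lbrakk>\<psi> \<in> R; f \<in> sk_funs \<psi>; length ts = length (frontier \<psi>);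
    \<forall>t\<in>set ts. t \<in> seeded R hc \<rho>; \<exists>t\<in>set ts. \<not> is_const t\<rbrakk>
    \<Longrightarrow> Fun f ts \<in> seeded R hc \<rho>"

section \<open>Closure of the seeded terms and simulation of a branch in the
  over-approximation\<close>

locale rule_base =
  fixes R :: "rule set" and hc :: head_choice and \<rho> :: rule
  assumes wf: "\<psi> \<in> R \<Longrightarrow> wf_rule \<psi>"
    and hc: "head_choice_for R hc"
    and rho: "\<rho> \<in> R"
begin

abbreviation "T \<equiv> seeded R hc \<rho>"

lemma hc_less: "\<psi> \<in> R \<Longrightarrow> hc \<psi> < branching \<psi>"
  using hc by (simp add: head_choice_for_def)

lemma seeded_sk_terms: "t \<in> T \<Longrightarrow> t \<in> sk_terms R"
proof (induction rule: seeded.induct)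
  case (seeded_base y)
  then show ?case
    using rho hc_less by (intro map_frontier_sk_terms) (auto simp: \<sigma>_uc_def intro: sk_terms.const)
qed (auto simp: \<sigma>_uc_def intro: sk_terms.intros)

lemma pure_seeded: "t \<in> T \<Longrightarrow> pure_term t"
  by (induction rule: seeded.induct) (auto simp: \<sigma>_uc_def)

lemma seeded_subterms: "t \<in> T \<Longrightarrow> s \<in> subterms t \<Longrightarrow> s \<in> T"
proof (induction arbitrary: s rule: seeded.induct)
  case (seeded_var x)
  then have "s = \<sigma>_uc x" by (simp add: \<sigma>_uc_def)
  with seeded_var show ?case by (simp add: seeded.seeded_var)
next
  case (seeded_base y)
  then consider "s = Fun (FSym \<rho> (hc \<rho>) y) (map \<sigma>_uc (frontier \<rho>))"
    | x where "x \<in> set (frontier \<rho>)" "s = \<sigma>_uc x"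
    by (auto simp: \<sigma>_uc_def)
  then show ?case
    using seeded_base frontier_subset by cases (auto intro: seeded.intros)
next
  case (seeded_func \<psi> f ts)
  then show ?case by (auto intro: seeded.seeded_func)
qed

lemma seeded_args: "Fun f ts \<in> T \<Longrightarrow> t \<in> set ts \<Longrightarrow> t \<in> T"
  by (erule seeded_subterms) (force intro: bexI[of _ t])

lemma seeded_Const: "Const c \<in> T \<Longrightarrow> \<exists>x\<in>univ_vars \<rho>. Const c = \<sigma>_uc x"
  by (cases rule: seeded.cases) auto

lemma seeded_base_subterm:
  "t \<in> T \<Longrightarrow> \<not> is_const t \<Longrightarrow>
    \<exists>y. Fun (FSym \<rho> (hc \<rho>) y) (map \<sigma>_uc (frontier \<rho>)) \<in> subterms t"
proof (induction rule: seeded.induct)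
  case (seeded_func \<psi> f ts)
  then show ?case by fastforce
qed (auto simp: \<sigma>_uc_def is_const_def)

text \<open>Needed because birth facts contain all Skolem terms of a trigger at once.\<close>

lemma seeded_sibling:
  assumes "Fun (FSym \<psi> i y) ts \<in> T" "z \<in> exist_vars i \<psi>"
  shows "Fun (FSym \<psi> i z) ts \<in> T"
  using assms(1)
proof cases
  case seeded_base
  then show ?thesis using assms(2) by (auto intro: seeded.seeded_base)
next
  case (seeded_func \<psi>')
  then have "\<psi>' = \<psi>" "i < branching \<psi>" by (auto simp: sk_funs_def)
  then show ?thesis
    using seeded_func assms(2) by (intro seeded.seeded_func[of \<psi>]) (auto simp: sk_funs_def)
qed (simp add: \<sigma>_uc_def)

lemma birth_seeded:
  assumes "t \<in> T" "A \<in> birth t" "a \<in> set (args A)"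
  shows "a \<in> T"
  using seeded_sk_terms[OF assms(1)] assms(2,3)
proof (cases rule: birth_args_cases)
  case 1
  then show ?thesis using assms(1) seeded_subterms by blast
next
  case (2 \<psi> i y z ts)
  then show ?thesis using assms(1) seeded_subterms seeded_sibling by blast
qed

lemma skel_seeded:
  assumes "\<And>x. x \<in> set (frontier \<psi>) \<Longrightarrow> \<sigma> x \<in> T"
  shows "skel (\<psi>, \<sigma>) \<subseteq> T"
proof
  fix t assume "t \<in> skel (\<psi>, \<sigma>)"
  then consider x A a where "x \<in> set (frontier \<psi>)" "A \<in> birth (\<sigma> x)" "a \<in> set (args A)"
      "t \<in> subterms a"
    | x where "x \<in> set (frontier \<psi>)" "t = \<sigma> x"
    by (auto simp: skel_def birth_trigger_def terms_of_def)
  then show "t \<in> T"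
  proof cases
    case 1
    then show ?thesis using birth_seeded[OF assms] seeded_subterms by blast
  qed (simp add: assms)
qed

lemma birth_wf:
  assumes "t \<in> sk_terms R" "A \<in> birth t"
  shows "pred_of A \<in> rule_preds R \<and> wf_atom A"
proof -
  obtain f ts where f: "Fun f ts \<in> subterms t" "A \<in> fsym_out f ts"
    using assms(2) by (auto simp: birth_iff)
  obtain \<psi> i y where "f = FSym \<psi> i y" "\<psi> \<in> R" "i < branching \<psi>"
    using sk_terms_subterms[OF assms(1) f(1)] by (elim sk_terms_Fun_cases)
  then show ?thesis using f(2) out_wf[of \<psi> R i A] wf by simp
qed

lemma trigger_on_seeded:
  "\<psi> \<in> R \<Longrightarrow> (\<And>x. x \<in> univ_vars \<psi> \<Longrightarrow> \<sigma> x \<in> T) \<Longrightarrow> trigger_on R (\<psi>, \<sigma>)"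
  by (simp add: trigger_on_def seeded_sk_terms)

text \<open>Reduces the comparison of two mapped outputs of one rule to its Skolem terms and its
  universal variables. It serves for the simulation of a branch and for the retraction along
  \<open>g\<close>.\<close>

lemma map_atom_out_cong:
  assumes "B \<in> set (head (hc \<chi>) \<chi>)"
    and "\<And>y. y \<in> exist_vars (hc \<chi>) \<chi> \<Longrightarrow>
      h (Fun (FSym \<chi> (hc \<chi>) y) (map \<nu> (frontier \<chi>))) =
      h' (Fun (FSym \<chi> (hc \<chi>) y) (map \<nu>' (frontier \<chi>)))"
    and "\<And>x. x \<in> univ_vars \<chi> \<Longrightarrow> h (\<nu> x) = h' (\<nu>' x)"
  shows "map_atom h (map_atom (sk_subst (hc \<chi>) (\<chi>, \<nu>)) B) =
    map_atom h' (map_atom (sk_subst (hc \<chi>) (\<chi>, \<nu>')) B)"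
  unfolding map_atom_comp
proof (rule map_atom_cong_args)
  fix v assume "v \<in> set (args B)"
  with assms(1) have "v \<in> exist_vars (hc \<chi>) \<chi> \<or> v \<in> univ_vars \<chi> \<and> v \<notin> exist_vars (hc \<chi>) \<chi>"
    by (auto simp: exist_vars_def atom_vars_def)
  then show "(h \<circ> sk_subst (hc \<chi>) (\<chi>, \<nu>)) v = (h' \<circ> sk_subst (hc \<chi>) (\<chi>, \<nu>')) v"
    using assms(2,3) by (auto simp: sk_subst_def)
qed

text \<open>Each trigger applied along the branch is repeated in the over-approximation with its
  values mapped by \<open>h_uc\<close>. This is permitted as long as its output is not the excluded
  one.\<close>

lemma reach_overapprox:
  assumes "reach R hc (rule_database \<rho>) F" "\<psi> \<in> R"
    and \<mu>: "\<And>x. x \<in> set (frontier \<psi>) \<Longrightarrow> \<mu> x \<in> T"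
    and "\<not> out_hc hc (\<psi>, \<mu>) \<subseteq> F"
  shows "map_atom (h_uc (\<psi>, \<mu>)) ` F \<subseteq> overapprox R hc (\<psi>, \<mu>) (h_uc (\<psi>, \<mu>))"
  using assms(1,4)
proof (induction rule: reach.induct)
  case reach_refl
  let ?h = "h_uc (\<psi>, \<mu>)"
  \<comment> \<open>The database contains only constants, each of which \<open>?h\<close> keeps or
    sends to \<open>Star\<close>; the images are base facts.\<close>
  have "map_atom ?h (map_atom \<sigma>_uc B) \<in> overapprox R hc (\<psi>, \<mu>) ?h" if "B \<in> set (body \<rho>)" for B
  proof (rule overapprox_baseI)
    show "pred_of (map_atom ?h (map_atom \<sigma>_uc B)) \<in> rule_preds R"
      using that rho by (simp add: rule_preds_body)
    show "wf_atom (map_atom ?h (map_atom \<sigma>_uc B))"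
      using that wf rho wf_rule_body by auto
  qed (auto simp: h_uc_def \<sigma>_uc_def is_const_def)
  then show ?case by (auto simp: rule_database_def inst_def)
next
  case (reach_step F \<kappa>)
  let ?h = "h_uc (\<psi>, \<mu>)"
  let ?O = "overapprox R hc (\<psi>, \<mu>) ?h"
  obtain \<chi> \<nu> where \<kappa>: "\<kappa> = (\<chi>, \<nu>)" by force
  have \<chi>: "\<chi> \<in> R" using reach_step.hyps \<kappa> by (simp add: trigger_on_def)
  have IH: "map_atom ?h ` F \<subseteq> ?O" using reach_step by blast
  have on: "trigger_on R (\<chi>, ?h \<circ> \<nu>)"
    using reach_step.hyps \<kappa> by (auto simp: trigger_on_def h_uc_sk_terms)
  have ld: "loaded (\<chi>, ?h \<circ> \<nu>) ?O"
    using reach_step.hyps(3) IH unfolding \<kappa> by (rule loaded_map)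
  have skel: "skel (\<psi>, \<mu>) \<subseteq> T" using \<mu> by (rule skel_seeded)
  \<comment> \<open>If the outputs agreed, the values \<open>?h (\<nu> x)\<close> visible in them
    would be pure, hence equal to \<open>\<nu> x\<close>. Then \<open>\<kappa>\<close> itself would
    have produced the output assumed to be missing.\<close>
  have ne: "out_hc hc (\<chi>, ?h \<circ> \<nu>) \<noteq> out_hc hc (\<psi>, \<mu>)"
  proof
    assume eq: "out_hc hc (\<chi>, ?h \<circ> \<nu>) = out_hc hc (\<psi>, \<mu>)"
    have "(?h \<circ> \<nu>) x = \<nu> x" if "x \<in> out_vars (hc \<chi>) \<chi>" for x
    proof -
      have "(?h \<circ> \<nu>) x \<in> terms_of (out (hc \<psi>) (\<psi>, \<mu>))"
        using out_vars_terms[OF that, of "?h \<circ> \<nu>"] eq by (simp add: out_hc_def)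
      then have "pure_term (?h (\<nu> x))"
        using pure_terms_out[of \<psi> \<mu> "hc \<psi>"] \<mu> pure_seeded hc_less assms(2) by simp
      then show ?thesis unfolding o_apply by (rule h_uc_pure)
    qed
    then have "out_hc hc (\<chi>, ?h \<circ> \<nu>) = out_hc hc (\<chi>, \<nu>)"
      unfolding out_hc_def fst_conv by (rule out_cong[OF hc_less[OF \<chi>]])
    with eq reach_step.prems \<kappa> show False by auto
  qed
  have "map_atom ?h A \<in> ?O" if A: "A \<in> out_hc hc \<kappa>" for A
  proof -
    obtain B where B: "B \<in> set (head (hc \<chi>) \<chi>)" "A = map_atom (sk_subst (hc \<chi>) (\<chi>, \<nu>)) B"
      using A \<kappa> by (auto simp: out_hc_def out_def inst_def)
    have "map_atom ?h A = map_atom ?h (map_atom (sk_subst (hc \<chi>) (\<chi>, ?h \<circ> \<nu>)) B)"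
      unfolding B(2)
    proof (rule map_atom_out_cong[OF B(1)])
      fix y
      let ?s = "Fun (FSym \<chi> (hc \<chi>) y) (map \<nu> (frontier \<chi>))"
      let ?s' = "Fun (FSym \<chi> (hc \<chi>) y) (map (?h \<circ> \<nu>) (frontier \<chi>))"
      \<comment> \<open>The two Skolem terms share their symbol. If one lies in the skeleton, so do
        its arguments; then \<open>?h\<close> left the arguments unchanged and the terms coincide.
        Otherwise both become the same constant \<open>CFun\<close>.\<close>
      have "?s = ?s'" if "?s \<in> skel (\<psi>, \<mu>)"
      proof -
        have "\<nu> x \<in> skel (\<psi>, \<mu>)" if "x \<in> set (frontier \<chi>)" for x
          using skel_subterms[OF \<open>?s \<in> _\<close>, of "\<nu> x"] that by force
        then show ?thesis by (simp add: h_uc_skel)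
      qed
      moreover have "?s = ?s'" if "?s' \<in> skel (\<psi>, \<mu>)"
      proof -
        have "?h (\<nu> x) \<in> skel (\<psi>, \<mu>)" if "x \<in> set (frontier \<chi>)" for x
          using skel_subterms[OF \<open>?s' \<in> _\<close>, of "?h (\<nu> x)"] that by force
        then have "?h (\<nu> x) = \<nu> x" if "x \<in> set (frontier \<chi>)" for x
          using that skel pure_seeded h_uc_pure by blast
        then show ?thesis by simp
      qed
      moreover have "?h ?s = ?h ?s'" if "?s \<notin> skel (\<psi>, \<mu>)" "?s' \<notin> skel (\<psi>, \<mu>)"
        using that by (simp add: h_uc_def)
      ultimately show "?h ?s = ?h ?s'" by metis
    qed simp
    moreover have "map_atom (sk_subst (hc \<chi>) (\<chi>, ?h \<circ> \<nu>)) B \<in> out_hc hc (\<chi>, ?h \<circ> \<nu>)"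
      using B(1) by (simp add: out_hc_def out_def inst_def)
    ultimately show ?thesis using overapprox.step[OF on ld ne] by metis
  qed
  with IH show ?case by auto
qed

lemma unblockable_out_hc:
  assumes F: "reach R hc (rule_database \<rho>) F" and sat: "\<And>\<psi>. \<psi> \<in> R \<Longrightarrow> satisfies F \<psi>"
    and \<psi>: "\<psi> \<in> R" and ld: "loaded (\<psi>, \<mu>) F"
    and \<mu>: "\<And>x. x \<in> set (frontier \<psi>) \<Longrightarrow> \<mu> x \<in> T"
    and unb: "uc_unblockable R hc (\<psi>, \<mu>)"
  shows "out_hc hc (\<psi>, \<mu>) \<subseteq> F"
proof (cases "datalog \<psi>")
  case True
  \<comment> \<open>With a single disjunct and no existential variables, being obsolete means that
    the output is present.\<close>
  have "obsolete (\<psi>, \<mu>) F" using sat[OF \<psi>] ld by (simp add: satisfies_def)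
  then obtain \<mu>' where \<mu>': "\<forall>x\<in>univ_vars \<psi>. \<mu>' x = \<mu> x" "inst \<mu>' (head 0 \<psi>) \<subseteq> F"
    using True by (auto simp: obsolete_def datalog_def)
  have "hc \<psi> = 0" "exist_vars 0 \<psi> = {}" using True hc_less[OF \<psi>] by (auto simp: datalog_def)
  then have "out_hc hc (\<psi>, \<mu>) = inst \<mu>' (head 0 \<psi>)"
    unfolding out_hc_def out_def using \<mu>'(1)
    by (auto simp: sk_subst_def exist_vars_def intro!: inst_cong)
  then show ?thesis using \<mu>'(2) by simp
next
  case False
  show ?thesis
  proof (rule ccontr)
    assume "\<not> ?thesis"
    from reach_overapprox[OF F \<psi> \<mu> this]
    have F_O: "map_atom (h_uc (\<psi>, \<mu>)) ` F \<subseteq> overapprox R hc (\<psi>, \<mu>) (h_uc (\<psi>, \<mu>))" .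
    have obs: "obsolete (\<psi>, \<mu>) F" using sat[OF \<psi>] ld by (simp add: satisfies_def)
    have "h_uc (\<psi>, \<mu>) (\<mu> x) = \<mu> x" if "x \<in> set (frontier \<psi>)" for x
      using frontier_value_skel[OF that] \<mu>[OF that] seeded_sk_terms by (intro h_uc_skel) blast
    with obs F_O have "obsolete (\<psi>, \<mu>) (overapprox R hc (\<psi>, \<mu>) (h_uc (\<psi>, \<mu>)))"
      by (rule obsolete_map)
    with unb False show False by (simp add: uc_unblockable_def)
  qed
qed

lemma unblockable_functional_frontier:
  assumes \<psi>: "\<psi> \<in> R" and nd: "\<not> datalog \<psi>"
    and \<mu>: "\<And>x. x \<in> set (frontier \<psi>) \<Longrightarrow> \<mu> x \<in> T"
    and unb: "uc_unblockable R hc (\<psi>, \<mu>)"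
  shows "\<exists>x\<in>set (frontier \<psi>). \<not> is_const (\<mu> x)"
proof (rule ccontr)
  assume const: "\<not> ?thesis"
  \<comment> \<open>Existential variables go to \<open>Star\<close> and frontier variables keep
    their constants, so the instantiated disjunct consists of base facts.\<close>
  let ?\<mu> = "\<lambda>x. if x \<in> univ_vars \<psi> then \<mu> x else Const Star"
  let ?O = "overapprox R hc (\<psi>, \<mu>) (h_uc (\<psi>, \<mu>))"
  have "map_atom ?\<mu> B \<in> ?O" if B: "B \<in> set (head (hc \<psi>) \<psi>)" for B
  proof (rule overapprox_baseI)
    show "pred_of (map_atom ?\<mu> B) \<in> rule_preds R"
      using rule_preds_head[OF \<psi> hc_less[OF \<psi>] B] by simp
    show "wf_atom (map_atom ?\<mu> B)"
      using wf_rule_head[OF wf[OF \<psi>] hc_less[OF \<psi>] B] by simp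
    fix a assume "a \<in> set (args (map_atom ?\<mu> B))"
    then obtain x where x: "x \<in> set (args B)" "a = ?\<mu> x" by auto
    show "a \<in> skel (\<psi>, \<mu>) \<and> is_const a \<or> a = Const Star"
    proof (cases "x \<in> univ_vars \<psi>")
      case True
      then have xf: "x \<in> set (frontier \<psi>)"
        using x(1) B hc_less[OF \<psi>] by (auto simp: set_frontier atom_vars_def)
      then have "\<mu> x \<in> skel (\<psi>, \<mu>)"
        using \<mu> seeded_sk_terms frontier_value_skel by blast
      then show ?thesis using True xf x(2) const by simp
    qed (use x in simp)
  qed
  then have "inst ?\<mu> (head (hc \<psi>) \<psi>) \<subseteq> ?O" by (auto simp: inst_def)
  then have "obsolete (\<psi>, \<mu>) ?O"
    unfolding obsolete_def using hc_less[OF \<psi>] by (intro exI[of _ ?\<mu>]) auto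
  with unb nd show False by (simp add: uc_unblockable_def)
qed

text \<open>A trigger with an existential variable in the chosen disjunct is not datalog, so
  \<open>unblockable_functional_frontier\<close> supplies the non-constant argument demanded by
  \<open>seeded_func\<close>.\<close>

lemma out_hc_seeded:
  assumes \<psi>: "\<psi> \<in> R" and \<mu>: "\<And>x. x \<in> set (frontier \<psi>) \<Longrightarrow> \<mu> x \<in> T"
    and unb: "uc_unblockable R hc (\<psi>, \<mu>)"
    and A: "A \<in> out_hc hc (\<psi>, \<mu>)" "a \<in> set (args A)"
  shows "a \<in> T"
proof -
  have "A \<in> out (hc \<psi>) (\<psi>, \<mu>)" using A by (simp add: out_hc_def)
  from this hc_less[OF \<psi>] A(2) show ?thesis
  proof (cases rule: args_out_cases)
    case (2 y)
    then have "\<not> datalog \<psi>" using datalog_no_exist_vars hc_less[OF \<psi>] by blast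
    then obtain x where "x \<in> set (frontier \<psi>)" "\<not> is_const (\<mu> x)"
      using unblockable_functional_frontier \<psi> \<mu> unb by blast
    then show ?thesis
      using 2 \<psi> \<mu> hc_less by (auto simp: sk_funs_def intro!: seeded.seeded_func[of \<psi>])
  qed (simp add: \<mu>)
qed

lemma RPC_facts_seeded:
  assumes "A \<in> RPC_facts R hc \<rho>" "a \<in> set (args A)"
  shows "a \<in> T"
  using assms
proof (induction arbitrary: a rule: RPC_facts.induct)
  case (db A)
  then show ?case
    unfolding rule_database_def inst_def by (force simp: univ_vars_def atom_vars_def intro: seeded_var)
next
  case (first A)
  then have "A \<in> out (hc \<rho>) (\<rho>, \<sigma>_uc)" by (simp add: out_hc_def)
  from this hc_less[OF rho] first.prems show ?case
    using frontier_subset by (cases rule: args_out_cases) (auto intro: seeded.intros)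
next
  case (step \<psi> \<tau> A)
  have "\<tau> x \<in> T" if "x \<in> univ_vars \<psi>" for x
    using loaded_value[OF step.IH that] by blast
  then show ?case
    using step.hyps step.prems frontier_subset
    by (intro out_hc_seeded[of \<psi> \<tau> A a]) (auto simp: trigger_on_def)
qed

end

section \<open>The substitution of a repeating trigger\<close>

text \<open>The terms that occur before any further trigger for \<open>\<rho>\<close> is applied satisfy this.\<close>

definition plain :: "rule \<Rightarrow> trm \<Rightarrow> bool" where
  "plain \<rho> t \<longleftrightarrow>
    (\<forall>i y ts. Fun (FSym \<rho> i y) ts \<in> subterms t \<longrightarrow> ts = map \<sigma>_uc (frontier \<rho>))"

fun subst :: "(var \<Rightarrow> trm) \<Rightarrow> trm \<Rightarrow> trm" where
  "subst \<tau> (Const c) = (case c of CVar x \<Rightarrow> \<tau> x | _ \<Rightarrow> Const c)"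
| "subst \<tau> (Fun f ts) = Fun f (map (subst \<tau>) ts)"

locale repeating_trigger = rule_base +
  fixes \<tau> :: "var \<Rightarrow> trm"
  assumes not_datalog: "\<not> datalog \<rho>"
    and unblockable: "uc_unblockable R hc (\<rho>, \<tau>)"
    and seeded: "x \<in> univ_vars \<rho> \<Longrightarrow> \<tau> x \<in> T"
    and inj: "inj_on \<tau> (univ_vars \<rho>)"
    and plain: "x \<in> univ_vars \<rho> \<Longrightarrow> plain \<rho> (\<tau> x)"
    and noncyclic: "x \<in> univ_vars \<rho> \<Longrightarrow> \<not> cyclic (\<tau> x)"
    and loaded: "loaded (\<rho>, \<tau>) (RPC_facts R hc \<rho>)"
begin

section \<open>Injectivity of the substitution and its effect on births and
  over-approximations\<close>

abbreviation "g \<equiv> subst \<tau>"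

lemma hom_g: "hom_on_funs g"
  by (simp add: hom_on_funs_def)

lemma g_\<sigma>_uc [simp]: "g (\<sigma>_uc x) = \<tau> x"
  by (simp add: \<sigma>_uc_def)

lemma functional_frontier: "\<exists>z\<in>set (frontier \<rho>). \<not> is_const (\<tau> z)"
  using rho not_datalog seeded unblockable frontier_subset
  by (intro unblockable_functional_frontier) auto

lemma g_seeded: "t \<in> T \<Longrightarrow> g t \<in> T"
proof (induction rule: seeded.induct)
  case (seeded_base y)
  have "\<forall>t\<in>set (map \<tau> (frontier \<rho>)). t \<in> T" using seeded frontier_subset by auto
  moreover have "\<exists>t\<in>set (map \<tau> (frontier \<rho>)). \<not> is_const t" using functional_frontier by simp
  ultimately have "Fun (FSym \<rho> (hc \<rho>) y) (map \<tau> (frontier \<rho>)) \<in> T"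
    using seeded_base rho hc_less by (intro seeded.seeded_func[of \<rho>]) (auto simp: sk_funs_def)
  then show ?case by (simp add: o_def)
next
  case (seeded_func \<psi> f ts)
  then obtain t where t: "t \<in> set ts" "\<not> is_const t" by blast
  from t(2) obtain f' ts' where "t = Fun f' ts'" by (cases t rule: trm.exhaust) (auto simp: is_const_def)
  then have "\<not> is_const (g t)" by (simp add: is_const_def)
  with t seeded_func show ?case
    unfolding subst.simps by (intro seeded.seeded_func[of \<psi>]) auto
qed (simp add: seeded)

text \<open>Here it matters that the repeating trigger is the earliest one: in a plain term the
  arguments of a Skolem term of \<rho> are constants, but \<open>\<tau>\<close> has a function term
  in the frontier.\<close>

lemma no_copy:
  assumes "x \<in> univ_vars \<rho>"
  shows "Fun (FSym \<rho> i y) (map \<tau> (frontier \<rho>)) \<notin> subterms (\<tau> x)"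
proof
  assume "Fun (FSym \<rho> i y) (map \<tau> (frontier \<rho>)) \<in> subterms (\<tau> x)"
  then have "map \<tau> (frontier \<rho>) = map \<sigma>_uc (frontier \<rho>)"
    using plain[OF assms] by (simp add: plain_def)
  then show False using functional_frontier by (auto simp: \<sigma>_uc_def is_const_def)
qed

text \<open>Every seeded function term contains an initial Skolem term, whose image under
  \<open>g\<close> is a Skolem term over \<open>\<tau>\<close>. This mark distinguishes images of
  function terms from the values of \<open>\<tau>\<close>.\<close>

lemma g_copy:
  assumes "t \<in> T" "\<not> is_const t"
  shows "\<exists>y. Fun (FSym \<rho> (hc \<rho>) y) (map \<tau> (frontier \<rho>)) \<in> subterms (g t)"
proof -
  obtain y where "Fun (FSym \<rho> (hc \<rho>) y) (map \<sigma>_uc (frontier \<rho>)) \<in> subterms t"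
    using seeded_base_subterm[OF assms] by blast
  from hom_on_funs_subterms[OF hom_g this] show ?thesis by (auto simp: o_def)
qed

lemma g_neq_\<tau>: "t \<in> T \<Longrightarrow> \<not> is_const t \<Longrightarrow> x \<in> univ_vars \<rho> \<Longrightarrow> g t \<noteq> \<tau> x"
  using g_copy no_copy by metis

text \<open>Birth facts add only siblings to the subterms of \<open>\<tau> x\<close>, and siblings
  have the same arguments, so the mark of \<open>g_copy\<close> among them would force a copy inside
  \<open>\<tau> x\<close>.\<close>

lemma g_not_in_birth:
  assumes u: "u \<in> T" "\<not> is_const u" and x: "x \<in> univ_vars \<rho>"
    and A: "A \<in> birth (\<tau> x)" "a \<in> set (args A)"
  shows "a \<noteq> g u"
proof
  assume "a = g u"
  then obtain y where y: "Fun (FSym \<rho> (hc \<rho>) y) (map \<tau> (frontier \<rho>)) \<in> subterms a"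
    using g_copy[OF u] by blast
  from seeded_sk_terms[OF seeded[OF x]] A show False
  proof (cases rule: birth_args_cases)
    case 1
    then show ?thesis using y no_copy[OF x] subterms_trans by blast
  next
    case (2 \<psi> i v z ts)
    show ?thesis
    proof (cases "Fun (FSym \<rho> (hc \<rho>) y) (map \<tau> (frontier \<rho>)) = a")
      case True
      then have "\<psi> = \<rho>" "ts = map \<tau> (frontier \<rho>)" using 2(1) by auto
      then show ?thesis using 2(2) no_copy[OF x] by blast
    next
      case False
      then have "Fun (FSym \<rho> (hc \<rho>) y) (map \<tau> (frontier \<rho>)) \<in> subterms (Fun (FSym \<psi> i v) ts)"
        using y 2 by auto
      then show ?thesis using 2(2) no_copy[OF x] subterms_trans by blast
    qed
  qed
qed

text \<open>Constants are separated by injectivity of \<open>\<tau>\<close>, a constant from a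
  function term by \<open>g_neq_\<tau>\<close>, and two function terms by induction on their
  arguments.\<close>

lemma g_inj: "s \<in> T \<Longrightarrow> t \<in> T \<Longrightarrow> g s = g t \<Longrightarrow> s = t"
proof (induction s arbitrary: t)
  case (Const c)
  then obtain x where x: "x \<in> univ_vars \<rho>" "Const c = \<sigma>_uc x" using seeded_Const by blast
  then have gt: "g t = \<tau> x" using Const by simp
  show ?case
  proof (cases t)
    case (Const d)
    then obtain x' where x': "x' \<in> univ_vars \<rho>" "t = \<sigma>_uc x'"
      using seeded_Const \<open>t \<in> T\<close> by blast
    with gt x inj show ?thesis by (auto dest: inj_onD)
  next
    case (Fun f ts)
    then show ?thesis using g_neq_\<tau>[OF \<open>t \<in> T\<close> _ x(1)] gt by (simp add: is_const_def)
  qed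
next
  case (Fun f ts)
  show ?case
  proof (cases t)
    case (Const d)
    then obtain x where x: "x \<in> univ_vars \<rho>" "t = \<sigma>_uc x" using seeded_Const Fun.prems by blast
    then show ?thesis
      using g_neq_\<tau>[OF Fun.prems(1) _ x(1)] Fun.prems(3) by (simp add: is_const_def)
  next
    case (Fun f' ts')
    have "\<forall>t\<in>set ts. t \<in> T" using seeded_args Fun.prems(1) by blast
    moreover have "\<forall>t\<in>set ts'. t \<in> T" using seeded_args Fun.prems(2) Fun by blast
    moreover have "f = f'" "map g ts = map g ts'" using Fun.prems(3) Fun by auto
    ultimately show ?thesis
      using Fun Fun.IH by (auto intro!: list.inj_map_strong[of ts ts' g g])
  qed
qed

lemma birth_g:
  assumes "t \<in> T" "A \<in> birth t"
  shows "map_atom g A \<in> birth (g t)"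
proof -
  obtain f ts where f: "Fun f ts \<in> subterms t" "A \<in> fsym_out f ts"
    using assms(2) by (auto simp: birth_iff)
  have "Fun f ts \<in> sk_terms R"
    using assms(1) f(1) seeded_sk_terms sk_terms_subterms by blast
  then have "map_atom g A \<in> fsym_out f (map g ts)"
    using fsym_out_map[OF hom_g] f(2) by blast
  moreover have "Fun f (map g ts) \<in> subterms (g t)"
    using hom_on_funs_subterms[OF hom_g f(1)] by simp
  ultimately show ?thesis unfolding birth_iff by blast
qed

text \<open>Function terms of \<open>g t\<close> are images of function terms of \<open>t\<close> or
  lie inside a substituted value; the births split accordingly.\<close>

lemma birth_g_cases:
  assumes "t \<in> T" "A \<in> birth (g t)"
  shows "(\<exists>A'\<in>birth t. A = map_atom g A') \<or> (\<exists>x\<in>univ_vars \<rho>. A \<in> birth (\<tau> x))"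
  using assms
proof (induction t rule: trm.induct)
  case (Const c)
  then obtain x where "x \<in> univ_vars \<rho>" "Const c = \<sigma>_uc x" using seeded_Const by blast
  then show ?case using Const.prems(2) by auto
next
  case (Fun f ts)
  from Fun.prems(2) consider "A \<in> fsym_out f (map g ts)" | t where "t \<in> set ts" "A \<in> birth (g t)" by auto
  then show ?case
  proof cases
    case 1
    then show ?thesis
      using fsym_out_map[OF hom_g seeded_sk_terms[OF Fun.prems(1)]] by auto
  next
    case 2
    then have "t \<in> T" using seeded_args Fun.prems(1) by blast
    then show ?thesis using Fun.IH 2 by fastforce
  qed
qed

lemma skel_g:
  assumes \<mu>: "\<And>x. x \<in> set (frontier \<psi>) \<Longrightarrow> \<mu> x \<in> T" and u: "u \<in> skel (\<psi>, \<mu>)"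
  shows "g u \<in> skel (\<psi>, g \<circ> \<mu>)"
proof -
  from u consider x A a where "x \<in> set (frontier \<psi>)" "A \<in> birth (\<mu> x)" "a \<in> set (args A)"
      "u \<in> subterms a"
    | x where "x \<in> set (frontier \<psi>)" "u = \<mu> x"
    by (auto simp: skel_def birth_trigger_def terms_of_def)
  then show ?thesis
  proof cases
    case 1
    then have "map_atom g A \<in> birth_trigger (\<psi>, g \<circ> \<mu>)"
      using birth_g \<mu> by (auto simp: birth_trigger_def)
    then have "g a \<in> skel (\<psi>, g \<circ> \<mu>)" using 1(3) by (intro skel_birth_args) auto
    then show ?thesis using 1(4) hom_on_funs_subterms[OF hom_g] skel_subterms by blast
  next
    case 2
    have "(g \<circ> \<mu>) x \<in> skel (\<psi>, g \<circ> \<mu>)"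
      by (rule frontier_value_skel[of x \<psi> "g \<circ> \<mu>" R]) (use 2 \<mu> g_seeded seeded_sk_terms in auto)
    then show ?thesis using 2 by simp
  qed
qed

text \<open>A left inverse of \<open>g\<close> on the skeleton maps the over-approximation of the instantiated
  trigger back into the one of the original trigger.\<close>

lemma overapprox_retract:
  fixes \<psi> \<mu>
  defines "S \<equiv> skel (\<psi>, \<mu>)"
  defines "r \<equiv> (\<lambda>a. if a \<in> g ` S then inv_into S g a
      else case a of Const (CFun f) \<Rightarrow> a | _ \<Rightarrow> Const Star)"
  assumes \<psi>: "\<psi> \<in> R" and \<mu>: "\<And>x. x \<in> set (frontier \<psi>) \<Longrightarrow> \<mu> x \<in> T"
    and A: "A \<in> overapprox R hc (\<psi>, g \<circ> \<mu>) (h_uc (\<psi>, g \<circ> \<mu>))"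
  shows "map_atom r A \<in> overapprox R hc (\<psi>, \<mu>) (h_uc (\<psi>, \<mu>))"
proof -
  let ?O = "overapprox R hc (\<psi>, \<mu>) (h_uc (\<psi>, \<mu>))"
  let ?O' = "overapprox R hc (\<psi>, g \<circ> \<mu>) (h_uc (\<psi>, g \<circ> \<mu>))"
  let ?h = "h_uc (\<psi>, \<mu>)"
  let ?h' = "h_uc (\<psi>, g \<circ> \<mu>)"
  let ?S' = "skel (\<psi>, g \<circ> \<mu>)"
  have g\<mu>: "(g \<circ> \<mu>) x \<in> T" if "x \<in> set (frontier \<psi>)" for x using that \<mu> g_seeded by simp
  have S_T: "S \<subseteq> T" unfolding S_def using \<mu> by (rule skel_seeded)
  have S'_T: "?S' \<subseteq> T" using g\<mu> by (rule skel_seeded)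
  have S_pure: "pure_term u" if "u \<in> S" for u using that S_T pure_seeded by blast
  have inj_S: "inj_on g S" using g_inj S_T by (auto intro!: inj_onI)
  have r_g: "r (g u) = u" if "u \<in> S" for u using that inj_S by (simp add: r_def)
  \<comment> \<open>\<open>r\<close> inverts \<open>g\<close> on the image of the skeleton, keeps
    the constants \<open>CFun f\<close> and collapses everything else to \<open>Star\<close>. All
    its values are therefore fixed by \<open>?h\<close>.\<close>
  have r_cases: "r a \<in> S \<and> g (r a) = a \<or> r a = Const Star \<or> (\<exists>f. r a = Const (CFun f) \<and> a = r a)"
    for a
    by (auto simp: r_def inv_into_into f_inv_into_f split: trm.split const.split)
  have CFun_notin: "Const (CFun f) \<notin> T" for f using pure_seeded[of "Const (CFun f)"] by auto
  have r_CFun: "r (Const (CFun f)) = Const (CFun f)" for f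
  proof -
    have "Const (CFun f) \<notin> g ` S" using CFun_notin g_seeded S_T by (metis imageE subsetD)
    then show ?thesis by (simp add: r_def)
  qed
  have r_pure: "r a \<in> S \<and> g (r a) = a" if "pure_term (r a)" for a
    using r_cases[of a] that by auto
  have h_r: "?h (r a) = r a" for a using r_cases[of a] by (auto simp: h_uc_skel S_def)
  have r_sk_terms: "r a \<in> sk_terms R" for a
    using r_cases[of a] S_T seeded_sk_terms by (auto intro: sk_terms.const)
  have r_Const: "r a \<in> S \<and> is_const (r a) \<or> r a = Const Star"
    if "a \<notin> range (Const \<circ> CFun)" "\<And>u. u \<in> S \<Longrightarrow> \<not> is_const u \<Longrightarrow> a \<noteq> g u" for a
    using r_cases[of a] that by force

  have birth_case: "map_atom r A \<in> ?O" if A: "A \<in> birth_trigger (\<psi>, g \<circ> \<mu>)" for A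
  proof -
    obtain x where x: "x \<in> set (frontier \<psi>)" "A \<in> birth (g (\<mu> x))"
      using A by (auto simp: birth_trigger_def)
    from birth_g_cases[OF \<mu>[OF x(1)] x(2)] show ?thesis
    proof (elim disjE bexE)
      fix A' assume A': "A' \<in> birth (\<mu> x)" "A = map_atom g A'"
      then have b: "A' \<in> birth_trigger (\<psi>, \<mu>)" using x(1) by (auto simp: birth_trigger_def)
      have "map_atom r A = map_atom (r \<circ> g) A'" using A' by simp
      also have "\<dots> = A'"
        using skel_birth_args[OF b] r_g by (intro map_atom_fixed) (simp add: S_def)
      finally show ?thesis using b overapprox.birth by simp
    next
      \<comment> \<open>Birth facts inherited from a value of \<open>\<tau>\<close> contain no image
        of a function term as an argument, so \<open>r\<close> turns them into base facts.\<close>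
      fix w assume w: "w \<in> univ_vars \<rho>" "A \<in> birth (\<tau> w)"
      have "pred_of A \<in> rule_preds R \<and> wf_atom A"
        using w birth_wf seeded seeded_sk_terms by blast
      then show ?thesis
      proof (intro overapprox_baseI)
        fix b assume "b \<in> set (args (map_atom r A))"
        then obtain a where a: "a \<in> set (args A)" "b = r a" by auto
        have "a \<in> T" using birth_seeded seeded w a by blast
        then have "a \<notin> range (Const \<circ> CFun)" using CFun_notin by auto
        moreover have "a \<noteq> g u" if "u \<in> S" "\<not> is_const u" for u
          using g_not_in_birth[of u w A a] that w a S_T by blast
        ultimately show "b \<in> skel (\<psi>, \<mu>) \<and> is_const b \<or> b = Const Star"
          using r_Const[of a] a(2) by (simp add: S_def)
      qed auto
    qed
  qed

  from A show ?thesis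
  proof (induction rule: overapprox.induct)
    case (base p ts)
    have "wf_atom (Atom p ts)" using base by (simp add: wf_atom_def)
    then have "map_atom r (Atom p ts) \<in> ?O"
    proof (intro overapprox_baseI)
      fix b assume "b \<in> set (args (map_atom r (Atom p ts)))"
      then obtain a where a: "a \<in> set ts" "b = r a" by auto
      then have c: "a \<in> ?S' \<and> is_const a \<or> a = Const Star" using base by blast
      then have "a \<notin> range (Const \<circ> CFun)" using CFun_notin S'_T by auto
      moreover have "a \<noteq> g u" if "\<not> is_const u" for u
        using c that by (cases u) (auto simp: is_const_def)
      ultimately show "b \<in> skel (\<psi>, \<mu>) \<and> is_const b \<or> b = Const Star"
        using r_Const[of a] a(2) by (simp add: S_def)
    qed (use base in \<open>auto simp: wf_atom_def\<close>)
    then show ?case .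
  next
    case (birth A)
    then show ?case by (rule birth_case)
  next
    case (step \<kappa> A)
    obtain \<chi> \<nu> where \<kappa>: "\<kappa> = (\<chi>, \<nu>)" by force
    have \<chi>: "\<chi> \<in> R" using step.hyps \<kappa> by (simp add: trigger_on_def)
    have ld': "loaded (\<chi>, \<nu>) ?O'"
      using step.IH \<kappa> by (auto elim!: loaded_subset)
    have ld: "loaded (\<chi>, r \<circ> \<nu>) ?O"
      using step.IH unfolding \<kappa> by (rule loaded_map) auto
    have on: "trigger_on R (\<chi>, r \<circ> \<nu>)"
      using \<chi> r_sk_terms by (simp add: trigger_on_def)
    have h'_\<nu>: "?h' (\<nu> x) = \<nu> x" if "x \<in> univ_vars \<chi>" for x
      using loaded_value[OF ld' that] overapprox_fixed by metis
    obtain B where B: "B \<in> set (head (hc \<chi>) \<chi>)" "A = map_atom (sk_subst (hc \<chi>) (\<chi>, \<nu>)) B"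
      using step.hyps \<kappa> by (auto simp: out_hc_def out_def inst_def)
    \<comment> \<open>If a new Skolem term lies in the skeleton of the instantiated trigger, the
      whole output consists of birth facts and \<open>birth_case\<close> applies. Otherwise the step
      is repeated with \<open>r \<circ> \<nu>\<close>.\<close>
    show ?case
    proof (cases "\<exists>y\<in>exist_vars (hc \<chi>) \<chi>. Fun (FSym \<chi> (hc \<chi>) y) (map \<nu> (frontier \<chi>)) \<in> ?S'")
      case True
      then obtain y where y: "Fun (FSym \<chi> (hc \<chi>) y) (map \<nu> (frontier \<chi>)) \<in> ?S'" by blast
      have "fsym_out (FSym \<chi> (hc \<chi>) y) (map \<nu> (frontier \<chi>)) \<subseteq> birth_trigger (\<psi>, g \<circ> \<mu>)"
        by (rule skel_fsym_out[OF _ y]) (use g\<mu> seeded_sk_terms in blast)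
      then have A: "A \<in> birth_trigger (\<psi>, g \<circ> \<mu>)"
        using step.hyps \<kappa> fsym_out_eq_out[OF hc_less[OF \<chi>]] by (auto simp: out_hc_def)
      then have "map_atom ?h' A = A"
        using skel_birth_args by (intro map_atom_fixed h_uc_skel)
      then show ?thesis using birth_case[OF A] by simp
    next
      case False
      \<comment> \<open>\<open>g\<close> undoes \<open>r\<close> on all values visible in the
        output, so applying \<open>g\<close> to equal outputs would yield the equality excluded by
        the given step.\<close>
      have ne: "out_hc hc (\<chi>, r \<circ> \<nu>) \<noteq> out_hc hc (\<psi>, \<mu>)"
      proof
        assume eq: "out_hc hc (\<chi>, r \<circ> \<nu>) = out_hc hc (\<psi>, \<mu>)"
        have "(g \<circ> (r \<circ> \<nu>)) x = \<nu> x" if "x \<in> out_vars (hc \<chi>) \<chi>" for x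
        proof -
          have "(r \<circ> \<nu>) x \<in> terms_of (out (hc \<psi>) (\<psi>, \<mu>))"
            using out_vars_terms[OF that, of "r \<circ> \<nu>"] eq by (simp add: out_hc_def)
          then have "pure_term (r (\<nu> x))"
            using pure_terms_out[of \<psi> \<mu> "hc \<psi>"] \<mu> pure_seeded hc_less \<psi> by simp
          then show ?thesis using r_pure by simp
        qed
        then have "out_hc hc (\<chi>, g \<circ> (r \<circ> \<nu>)) = out_hc hc (\<chi>, \<nu>)"
          unfolding out_hc_def fst_conv by (rule out_cong[OF hc_less[OF \<chi>]])
        then have "out_hc hc (\<chi>, \<nu>) = map_atom g ` out_hc hc (\<psi>, \<mu>)"
          using eq hom_out_hc[OF hom_g] by metis
        then show False using step.hyps \<kappa> hom_out_hc[OF hom_g] by metis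
      qed
      have "map_atom r (map_atom ?h' A) =
          map_atom ?h (map_atom (sk_subst (hc \<chi>) (\<chi>, r \<circ> \<nu>)) B)"
        unfolding B(2) map_atom_comp[of r ?h']
      proof (rule map_atom_out_cong[OF B(1)])
        fix y assume y: "y \<in> exist_vars (hc \<chi>) \<chi>"
        let ?t = "Fun (FSym \<chi> (hc \<chi>) y) (map \<nu> (frontier \<chi>))"
        let ?t' = "Fun (FSym \<chi> (hc \<chi>) y) (map (r \<circ> \<nu>) (frontier \<chi>))"
        have t: "?t \<notin> ?S'" using False y by blast
        \<comment> \<open>Otherwise \<open>g ?t'\<close> equals \<open>?t\<close> and lies in the
          skeleton by \<open>skel_g\<close>. Hence both Skolem terms are replaced by the same
          constant \<open>CFun\<close>, which \<open>r\<close> keeps.\<close>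
        have "?t' \<notin> S"
        proof
          assume t': "?t' \<in> S"
          have "r (\<nu> x) \<in> S" if "x \<in> set (frontier \<chi>)" for x
            using skel_subterms[OF t'[unfolded S_def], of "r (\<nu> x)"] that by (force simp: S_def)
          then have "g (r (\<nu> x)) = \<nu> x" if "x \<in> set (frontier \<chi>)" for x
            using that S_pure r_pure by blast
          then have "g ?t' = ?t" by simp
          moreover have "g ?t' \<in> ?S'" using skel_g[of \<psi> \<mu>, OF \<mu>] t' unfolding S_def by blast
          ultimately show False using t by metis
        qed
        then show "(r \<circ> ?h') ?t = ?h ?t'"
          using t r_CFun by (simp add: h_uc_def S_def)
      next
        fix x assume "x \<in> univ_vars \<chi>"
        then show "(r \<circ> ?h') (\<nu> x) = ?h ((r \<circ> \<nu>) x)" using h'_\<nu> h_r by simp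
      qed
      moreover have "map_atom (sk_subst (hc \<chi>) (\<chi>, r \<circ> \<nu>)) B \<in> out_hc hc (\<chi>, r \<circ> \<nu>)"
        using B(1) by (simp add: out_hc_def out_def inst_def)
      ultimately show ?thesis using overapprox.step[OF on ld ne] by metis
    qed
  qed
qed

text \<open>The retraction sends each frontier value \<open>g (\<mu> x)\<close> back to
  \<open>\<mu> x\<close>, so if the instance were obsolete, the original trigger would be as
  well.\<close>

lemma unblockable_g:
  assumes \<psi>: "\<psi> \<in> R" and \<mu>: "\<And>x. x \<in> set (frontier \<psi>) \<Longrightarrow> \<mu> x \<in> T"
    and unb: "uc_unblockable R hc (\<psi>, \<mu>)"
  shows "uc_unblockable R hc (\<psi>, g \<circ> \<mu>)"
proof (rule ccontr)
  let ?S = "skel (\<psi>, \<mu>)"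
  let ?r = "\<lambda>a. if a \<in> g ` ?S then inv_into ?S g a
      else case a of Const (CFun f) \<Rightarrow> a | _ \<Rightarrow> Const Star"
  assume "\<not> ?thesis"
  then have nd: "\<not> datalog \<psi>"
    and obs: "obsolete (\<psi>, g \<circ> \<mu>) (overapprox R hc (\<psi>, g \<circ> \<mu>) (h_uc (\<psi>, g \<circ> \<mu>)))"
    by (auto simp: uc_unblockable_def)
  have "obsolete (\<psi>, \<mu>) (overapprox R hc (\<psi>, \<mu>) (h_uc (\<psi>, \<mu>)))"
  proof (rule obsolete_map[OF obs])
    show "map_atom ?r ` overapprox R hc (\<psi>, g \<circ> \<mu>) (h_uc (\<psi>, g \<circ> \<mu>))
        \<subseteq> overapprox R hc (\<psi>, \<mu>) (h_uc (\<psi>, \<mu>))"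
      using overapprox_retract[of \<psi> \<mu>, OF \<psi> \<mu>] by (intro image_subsetI)
    fix x assume x: "x \<in> set (frontier \<psi>)"
    then have "\<mu> x \<in> ?S" using \<mu> seeded_sk_terms frontier_value_skel by blast
    moreover have "?S \<subseteq> T" using \<mu> by (rule skel_seeded)
    then have "inj_on g ?S" using g_inj unfolding inj_on_def by blast
    ultimately show "?r ((g \<circ> \<mu>) x) = \<mu> x" by simp
  qed
  with unb nd show False by (simp add: uc_unblockable_def)
qed

section \<open>Iterating the substitution\<close>

lemma out_hc_\<tau>: "out_hc hc (\<rho>, \<tau>) \<subseteq> RPC_facts R hc \<rho>"
  using RPC_facts.step[of R \<rho> \<tau> hc \<rho>] trigger_on_seeded[OF rho] seeded noncyclic loaded unblockable inj
  by blast

lemma iterate_unblockable: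
  assumes \<psi>: "\<psi> \<in> R" and \<mu>: "\<And>x. x \<in> set (frontier \<psi>) \<Longrightarrow> \<mu> x \<in> T"
    and unb: "uc_unblockable R hc (\<psi>, \<mu>)"
  shows "uc_unblockable R hc (\<psi>, (g ^^ n) \<circ> \<mu>) \<and> (\<forall>x\<in>set (frontier \<psi>). (g ^^ n) (\<mu> x) \<in> T)"
proof (induction n)
  case 0
  then show ?case using \<mu> unb by (simp add: o_def)
next
  case (Suc n)
  then have "uc_unblockable R hc (\<psi>, (g ^^ n) \<circ> \<mu>)" by blast
  with Suc have "uc_unblockable R hc (\<psi>, g \<circ> ((g ^^ n) \<circ> \<mu>))"
    by (intro unblockable_g[OF \<psi>]) (simp_all only: o_apply)
  then have "uc_unblockable R hc (\<psi>, (g ^^ Suc n) \<circ> \<mu>)" by (simp only: funpow.simps o_assoc)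
  moreover have "(g ^^ Suc n) (\<mu> x) \<in> T" if "x \<in> set (frontier \<psi>)" for x
    using Suc that by (simp add: g_seeded)
  ultimately show ?case by blast
qed

text \<open>Outer induction on \<open>n\<close>, inner induction on the derivation. One application
  of \<open>g\<close> turns the database and the first output into the loaded body and the output of
  \<open>(\<rho>, \<tau>)\<close>, which are again facts of the fixpoint; the outer hypothesis
  covers them. Later triggers stay unblockable under iteration.\<close>

lemma iterate_RPC_facts:
  assumes F: "reach R hc (rule_database \<rho>) F" and sat: "\<And>\<psi>. \<psi> \<in> R \<Longrightarrow> satisfies F \<psi>"
    and first: "rule_database \<rho> \<subseteq> F" "out_hc hc (\<rho>, \<sigma>_uc) \<subseteq> F"
  shows "A \<in> RPC_facts R hc \<rho> \<Longrightarrow> map_atom (g ^^ n) A \<in> F"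
proof (induction n arbitrary: A)
  case 0
  then show ?case
  proof (induction rule: RPC_facts.induct)
    case (step \<psi> \<mu> A)
    have ld: "loaded (\<psi>, \<mu>) F"
      using step.IH by (rule loaded_subset) (auto simp: atom.map_ident)
    have "\<mu> x \<in> T" if "x \<in> univ_vars \<psi>" for x
      using loaded_value[OF step.IH that] RPC_facts_seeded by blast
    then have "out_hc hc (\<psi>, \<mu>) \<subseteq> F"
      using step.hyps frontier_subset
      by (intro unblockable_out_hc[OF F sat _ ld]) (auto simp: trigger_on_def)
    with step.hyps show ?case by (auto simp: atom.map_ident)
  qed (use first in \<open>auto simp: atom.map_ident\<close>)
next
  case (Suc n)
  let ?g = "g ^^ n"
  have shift: "map_atom (g ^^ Suc n) ` inst \<sigma>_uc As = map_atom ?g ` inst \<tau> As" for As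
    by (simp add: map_atom_inst funpow_Suc_right o_def del: funpow.simps)
  have hom: "hom_on_funs (g ^^ m)" for m by (rule hom_on_funs_funpow[OF hom_g])
  from Suc.prems show ?case
  proof (induction rule: RPC_facts.induct)
    case (db A)
    then have "map_atom (g ^^ Suc n) A \<in> map_atom ?g ` inst \<tau> (body \<rho>)"
      unfolding shift[symmetric] rule_database_def by blast
    moreover have "inst \<tau> (body \<rho>) \<subseteq> RPC_facts R hc \<rho>" using loaded by (simp add: loaded_def)
    ultimately show ?case using Suc.IH by (metis imageE subsetD)
  next
    case (first A)
    have "(g ^^ Suc n) \<circ> \<sigma>_uc = ?g \<circ> \<tau>"
      by (simp add: fun_eq_iff funpow_Suc_right del: funpow.simps)
    then have "map_atom (g ^^ Suc n) A \<in> out_hc hc (\<rho>, ?g \<circ> \<tau>)"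
      using first hom_out_hc[OF hom] by (metis imageI)
    then have "map_atom (g ^^ Suc n) A \<in> map_atom ?g ` out_hc hc (\<rho>, \<tau>)"
      unfolding hom_out_hc[OF hom] .
    then obtain A' where A': "map_atom (g ^^ Suc n) A = map_atom ?g A'" "A' \<in> out_hc hc (\<rho>, \<tau>)"
      by (elim imageE)
    show ?case unfolding A'(1) using A'(2) out_hc_\<tau> by (intro Suc.IH) blast
  next
    case (step \<psi> \<mu> A)
    let ?g' = "g ^^ Suc n"
    have \<psi>: "\<psi> \<in> R" using step.hyps by (simp add: trigger_on_def)
    have ld: "loaded (\<psi>, ?g' \<circ> \<mu>) F"
      using step.IH by (rule loaded_map) (auto simp: o_def)
    have "\<mu> x \<in> T" if "x \<in> univ_vars \<psi>" for x
      using loaded_value[OF step.IH that] RPC_facts_seeded by blast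
    then have \<mu>: "\<mu> x \<in> T" if "x \<in> set (frontier \<psi>)" for x
      using that frontier_subset by blast
    have unb: "uc_unblockable R hc (\<psi>, \<mu>)" using step.hyps by blast
    have "out_hc hc (\<psi>, ?g' \<circ> \<mu>) \<subseteq> F"
      by (rule unblockable_out_hc[OF F sat \<psi> ld])
        (use iterate_unblockable[OF \<psi> \<mu> unb, of "Suc n"] in \<open>simp_all del: funpow.simps\<close>)
    moreover have "map_atom ?g' A \<in> out_hc hc (\<psi>, ?g' \<circ> \<mu>)"
      unfolding hom_out_hc[OF hom, symmetric] using step.hyps by (intro imageI) blast
    ultimately show ?case by (rule subsetD)
  qed
qed

lemma infinite_model:
  assumes F: "reach R hc (rule_database \<rho>) F" and sat: "\<And>\<psi>. \<psi> \<in> R \<Longrightarrow> satisfies F \<psi>"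
    and first: "rule_database \<rho> \<subseteq> F" "out_hc hc (\<rho>, \<sigma>_uc) \<subseteq> F"
  shows "infinite F"
proof
  assume "finite F"
  obtain z where z: "z \<in> set (frontier \<rho>)" "\<not> is_const (\<tau> z)" using functional_frontier by blast
  then have zu: "z \<in> univ_vars \<rho>" using frontier_subset by blast
  let ?t = "\<lambda>n. (g ^^ n) (\<sigma>_uc z)"
  \<comment> \<open>\<open>\<tau> z\<close> contains an initial Skolem term, which has
    \<open>\<sigma>_uc z\<close> as an argument because \<open>z\<close> is in the frontier.
    Applying \<open>g ^^ n\<close> makes \<open>?t n\<close> a proper subterm of
    \<open>?t (Suc n)\<close>.\<close>
  have "size (?t n) < size (?t (Suc n))" for n
  proof -
    have hom: "hom_on_funs (g ^^ n)" by (rule hom_on_funs_funpow[OF hom_g])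
    obtain y where "Fun (FSym \<rho> (hc \<rho>) y) (map \<sigma>_uc (frontier \<rho>)) \<in> subterms (\<tau> z)"
      using seeded_base_subterm seeded zu z(2) by blast
    from hom_on_funs_subterms[OF hom this]
    have "Fun (FSym \<rho> (hc \<rho>) y) (map ((g ^^ n) \<circ> \<sigma>_uc) (frontier \<rho>)) \<in> subterms ((g ^^ n) (\<tau> z))"
      by (simp add: hom_on_funsD[OF hom])
    then have "size (Fun (FSym \<rho> (hc \<rho>) y) (map ((g ^^ n) \<circ> \<sigma>_uc) (frontier \<rho>))) \<le> size ((g ^^ n) (\<tau> z))"
      by (rule size_subterms)
    moreover have "size (?t n) < size (Fun (FSym \<rho> (hc \<rho>) y) (map ((g ^^ n) \<circ> \<sigma>_uc) (frontier \<rho>)))"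
      using z(1) by (intro size_arg) auto
    moreover have "?t (Suc n) = (g ^^ n) (\<tau> z)"
      by (simp add: funpow_Suc_right del: funpow.simps)
    ultimately show ?thesis by simp
  qed
  then have "strict_mono (\<lambda>n. size (?t n))" by (simp add: strict_mono_Suc_iff)
  then have "inj ?t" by (intro injI) (metis strict_mono_eq)
  then have "infinite (range ?t)" using finite_imageD infinite_UNIV_nat by blast
  moreover have "range ?t \<subseteq> (\<Union>A\<in>F. set (args A))"
  proof (intro image_subsetI)
    fix n
    obtain B where B: "B \<in> set (body \<rho>)" "z \<in> set (args B)"
      using zu by (auto simp: univ_vars_def atom_vars_def)
    then have "map_atom \<sigma>_uc B \<in> RPC_facts R hc \<rho>"
      by (intro RPC_facts.db) (simp add: rule_database_def inst_def)
    from iterate_RPC_facts[OF F sat first this, of n] B(2)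
    show "?t n \<in> (\<Union>A\<in>F. set (args A))" by (intro UN_I) auto
  qed
  moreover have "finite (\<Union>A\<in>F. set (args A))" using \<open>finite F\<close> by simp
  ultimately show False using finite_subset by blast
qed

end

section \<open>The database\<close>

text \<open>Among the vertices satisfying the invariant, one of maximal depth is a leaf, since
  otherwise its child chosen by \<open>hc\<close> would satisfy the invariant at greater
  depth.\<close>

lemma chase_tree_leaf:
  assumes tree: "chase_tree R D V fct" "finite V" and hc: "head_choice_for R hc"
    and init: "P D"
    and step: "\<And>F \<kappa>. P F \<Longrightarrow> trigger_on R \<kappa> \<Longrightarrow> loaded \<kappa> F \<Longrightarrow> \<not> obsolete \<kappa> F \<Longrightarrow>
      P (F \<union> out_hc hc \<kappa>)"
  shows "\<exists>F. P F \<and> (\<forall>\<rho>\<in>R. satisfies F \<rho>)"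
proof -
  let ?W = "{v\<in>V. P (fct v)}"
  have "[] \<in> ?W" using tree(1) init by (simp add: chase_tree_def)
  moreover have "finite ?W" using tree(2) by simp
  ultimately have "Max (length ` ?W) \<in> length ` ?W" by (intro Max_in) auto
  then obtain v where v: "v \<in> ?W" "length v = Max (length ` ?W)" by auto
  have max: "length w \<le> length v" if "w \<in> ?W" for w
    unfolding v(2) using that tree(2) by (intro Max_ge) auto
  have "leaf V v"
  proof (rule ccontr)
    assume "\<not> leaf V v"
    then obtain \<kappa> where \<kappa>: "chase_step R V fct v \<kappa>"
      using tree(1) v(1) by (auto simp: chase_tree_def)
    then have "hc (fst \<kappa>) < branching (fst \<kappa>)"
      using hc by (auto simp: chase_step_def trigger_on_def head_choice_for_def)
    then have "v @ [hc (fst \<kappa>)] \<in> V" "fct (v @ [hc (fst \<kappa>)]) = fct v \<union> out_hc hc \<kappa>"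
      using \<kappa> by (auto simp: chase_step_def out_hc_def)
    moreover have "P (fct v \<union> out_hc hc \<kappa>)"
      using \<kappa> v(1) by (intro step) (auto simp: chase_step_def)
    ultimately have "v @ [hc (fst \<kappa>)] \<in> ?W" by simp
    from max[OF this] show False by simp
  qed
  then have "\<forall>\<rho>\<in>R. satisfies (fct v) \<rho>" using tree(1) by (simp add: chase_tree_def)
  with v(1) show ?thesis by blast
qed

text \<open>Starting the chase on \<open>rule_database \<rho>\<close> does not work, since the initial trigger may be
  blocked by others. Instead, the chase starts with its result already present, but with
  constants \<open>Name y\<close> in place of the Skolem terms. The initial trigger is then obsolete forever,
  so these Skolem terms never occur, and the constants can be replaced by them injectively.\<close>

definition named_subst :: "nat \<Rightarrow> rule \<Rightarrow> var \<Rightarrow> trm" where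
  "named_subst i \<rho> v = (if v \<in> exist_vars i \<rho> then Const (Name v) else \<sigma>_uc v)"

definition named_database :: "nat \<Rightarrow> rule \<Rightarrow> fact set" where
  "named_database i \<rho> = rule_database \<rho> \<union> inst (named_subst i \<rho>) (head i \<rho>)"

fun unname :: "nat \<Rightarrow> rule \<Rightarrow> trm \<Rightarrow> trm" where
  "unname i \<rho> (Const c) = (case c of
      Name y \<Rightarrow> if y \<in> exist_vars i \<rho> then Fun (FSym \<rho> i y) (map \<sigma>_uc (frontier \<rho>)) else Const c
    | _ \<Rightarrow> Const c)"
| "unname i \<rho> (Fun f ts) = Fun f (map (unname i \<rho>) ts)"

text \<open>Describes terms on which \<open>unname\<close> is injective: the only possible clash is
  between a name and the Skolem term replacing it.\<close>

definition no_base_terms :: "nat \<Rightarrow> rule \<Rightarrow> trm \<Rightarrow> bool" where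
  "no_base_terms i \<rho> t \<longleftrightarrow> (\<forall>y. Fun (FSym \<rho> i y) (map \<sigma>_uc (frontier \<rho>)) \<notin> subterms t)"

section \<open>Injectivity of \<open>unname\<close>\<close>

lemma hom_unname: "hom_on_funs (unname i \<rho>)"
  by (simp add: hom_on_funs_def)

lemma unname_\<sigma>_uc [simp]: "unname i \<rho> (\<sigma>_uc x) = \<sigma>_uc x"
  by (simp add: \<sigma>_uc_def)

lemma no_base_terms_arg: "no_base_terms i \<rho> (Fun f ts) \<Longrightarrow> t \<in> set ts \<Longrightarrow> no_base_terms i \<rho> t"
  by (auto simp: no_base_terms_def)

lemma unname_eq_base:
  assumes "unname i \<rho> t = \<sigma>_uc x"
  shows "t = \<sigma>_uc x"
  using assms by (cases t) (auto simp: \<sigma>_uc_def split: const.splits if_splits)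

text \<open>Only \<open>\<sigma>_uc x\<close> itself is mapped to \<open>\<sigma>_uc x\<close>, so a
  function term whose image is an initial Skolem term would be that term already.\<close>

lemma unname_neq_base:
  assumes "no_base_terms i \<rho> (Fun f ts)"
  shows "unname i \<rho> (Fun f ts) \<noteq> Fun (FSym \<rho> i y) (map \<sigma>_uc (frontier \<rho>))"
proof
  assume eq: "unname i \<rho> (Fun f ts) = Fun (FSym \<rho> i y) (map \<sigma>_uc (frontier \<rho>))"
  then have "length ts = length (frontier \<rho>)" by (auto dest: map_eq_imp_length_eq)
  moreover have "ts ! k = \<sigma>_uc (frontier \<rho> ! k)" if "k < length ts" for k
  proof -
    have "map (unname i \<rho>) ts ! k = map \<sigma>_uc (frontier \<rho>) ! k" using eq by simp
    then show ?thesis using that calculation by (auto intro: unname_eq_base)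
  qed
  ultimately have "ts = map \<sigma>_uc (frontier \<rho>)" by (intro nth_equalityI) auto
  with eq assms show False by (auto simp: no_base_terms_def)
qed

lemma unname_Const_neq_Fun:
  assumes "no_base_terms i \<rho> (Fun f ts)"
  shows "unname i \<rho> (Const c) \<noteq> unname i \<rho> (Fun f ts)"
proof
  assume eq: "unname i \<rho> (Const c) = unname i \<rho> (Fun f ts)"
  then obtain y where "unname i \<rho> (Const c) = Fun (FSym \<rho> i y) (map \<sigma>_uc (frontier \<rho>))"
    by (auto split: const.splits if_splits)
  with eq unname_neq_base[OF assms, of y] show False by metis
qed

lemma unname_inj:
  "no_base_terms i \<rho> s \<Longrightarrow> no_base_terms i \<rho> t \<Longrightarrow> unname i \<rho> s = unname i \<rho> t \<Longrightarrow> s = t"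
proof (induction s arbitrary: t)
  case (Const c)
  show ?case
  proof (cases t)
    case (Const d)
    with Const.prems show ?thesis by (auto split: const.splits if_splits)
  next
    case (Fun f ts)
    with Const.prems unname_Const_neq_Fun show ?thesis by metis
  qed
next
  case (Fun f ts)
  show ?case
  proof (cases t)
    case (Const d)
    with Fun.prems unname_Const_neq_Fun show ?thesis by metis
  next
    case t: (Fun f' ts')
    with Fun.prems have "f = f'" "map (unname i \<rho>) ts = map (unname i \<rho>) ts'" by auto
    moreover have "x = y" if "x \<in> set ts" "y \<in> set ts'" "unname i \<rho> x = unname i \<rho> y" for x y
      using Fun.IH that Fun.prems t no_base_terms_arg by blast
    ultimately show ?thesis
      using t list.inj_map_strong[of ts ts' "unname i \<rho>" "unname i \<rho>"] by simp
  qed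
qed

section \<open>The chase on the named database\<close>

context rule_base
begin

lemma unname_sk_terms: "t \<in> sk_terms R \<Longrightarrow> unname (hc \<rho>) \<rho> t \<in> sk_terms R"
proof (induction rule: sk_terms.induct)
  case (const c)
  have "Fun (FSym \<rho> (hc \<rho>) y) (map \<sigma>_uc (frontier \<rho>)) \<in> sk_terms R" if "y \<in> exist_vars (hc \<rho>) \<rho>" for y
    using that seeded_base seeded_sk_terms by blast
  then show ?case by (auto split: const.split intro: sk_terms.const)
next
  case (func \<psi> f ts)
  then show ?case unfolding unname.simps by (intro sk_terms.func[of \<psi>]) auto
qed

lemma database_named: "database (named_database (hc \<rho>) \<rho>)"
proof -
  have "wf_atom A" if "A \<in> set (body \<rho>) \<or> A \<in> set (head (hc \<rho>) \<rho>)" for A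
    using that wf[OF rho] wf_rule_body wf_rule_head hc_less[OF rho] by blast
  then show ?thesis
    by (auto simp: database_def named_database_def rule_database_def inst_def is_const_def
        \<sigma>_uc_def named_subst_def)
qed

lemma unname_named_database:
  "map_atom (unname (hc \<rho>) \<rho>) ` named_database (hc \<rho>) \<rho> = rule_database \<rho> \<union> out_hc hc (\<rho>, \<sigma>_uc)"
proof -
  have "unname (hc \<rho>) \<rho> \<circ> \<sigma>_uc = \<sigma>_uc" by (simp add: fun_eq_iff)
  moreover have "unname (hc \<rho>) \<rho> \<circ> named_subst (hc \<rho>) \<rho> = sk_subst (hc \<rho>) (\<rho>, \<sigma>_uc)"
    by (auto simp: fun_eq_iff named_subst_def sk_subst_def)
  ultimately show ?thesis
    by (simp add: named_database_def rule_database_def image_Un map_atom_inst out_hc_def out_def)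
qed

text \<open>Invariant of the branch following \<open>hc\<close>: the first trigger stays obsolete,
  \<open>unname\<close> stays injective, and the renamed facts form a run from the plain
  rule-database.\<close>

definition branch_facts :: "fact set \<Rightarrow> bool" where
  "branch_facts F \<longleftrightarrow> named_database (hc \<rho>) \<rho> \<subseteq> F \<and>
    (\<forall>A\<in>F. \<forall>a\<in>set (args A). no_base_terms (hc \<rho>) \<rho> a) \<and>
    reach R hc (rule_database \<rho>) (map_atom (unname (hc \<rho>) \<rho>) ` F)"

lemma branch_facts_named_database: "branch_facts (named_database (hc \<rho>) \<rho>)"
proof -
  have "no_base_terms (hc \<rho>) \<rho> a" if "A \<in> named_database (hc \<rho>) \<rho>" "a \<in> set (args A)" for A a
    using that database_named by (fastforce simp: database_def is_const_def no_base_terms_def)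
  \<comment> \<open>The renamed start of the chase is the rule-database after one application of the
    initial trigger.\<close>
  moreover have "reach R hc (rule_database \<rho>) (rule_database \<rho> \<union> out_hc hc (\<rho>, \<sigma>_uc))"
    using rho seeded_var by (intro reach_step reach_refl trigger_on_seeded)
      (auto simp: loaded_def rule_database_def)
  ultimately show ?thesis by (simp add: branch_facts_def unname_named_database)
qed

lemma obsolete_first_trigger:
  assumes "named_database (hc \<rho>) \<rho> \<subseteq> F" "map \<nu> (frontier \<rho>) = map \<sigma>_uc (frontier \<rho>)"
  shows "obsolete (\<rho>, \<nu>) F"
proof -
  have "obsolete (\<rho>, \<sigma>_uc) F"
    unfolding obsolete_def using assms(1) hc_less[OF rho]
    by (intro exI[of _ "named_subst (hc \<rho>) \<rho>"])
      (auto simp: named_database_def named_subst_def exist_vars_def)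
  from obsolete_map[OF this, of id] show ?thesis
    using assms(2) by (simp add: atom.map_id)
qed

lemma branch_facts_step:
  assumes F: "branch_facts F" and on: "trigger_on R \<kappa>" and ld: "loaded \<kappa> F"
    and nobs: "\<not> obsolete \<kappa> F"
  shows "branch_facts (F \<union> out_hc hc \<kappa>)"
proof -
  obtain \<chi> \<nu> where \<kappa>: "\<kappa> = (\<chi>, \<nu>)" by force
  have \<chi>: "\<chi> \<in> R" using on \<kappa> by (simp add: trigger_on_def)
  let ?E = "unname (hc \<rho>) \<rho>"
  have no_base: "no_base_terms (hc \<rho>) \<rho> (\<nu> x)" if "x \<in> set (frontier \<chi>)" for x
    using loaded_value[OF ld[unfolded \<kappa>]] that frontier_subset F
    by (metis branch_facts_def subsetD)
  have "no_base_terms (hc \<rho>) \<rho> a" if A: "A \<in> out_hc hc \<kappa>" "a \<in> set (args A)" for A a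
  proof -
    have "A \<in> out (hc \<chi>) (\<chi>, \<nu>)" using A \<kappa> by (simp add: out_hc_def)
    from this hc_less[OF \<chi>] A(2) show ?thesis
    proof (cases rule: args_out_cases)
      case (2 y)
      \<comment> \<open>A new initial Skolem term could come only from a trigger for \<rho> that
        agrees with \<open>\<sigma>_uc\<close> on the frontier, but the named constants make such a
        trigger obsolete.\<close>
      have "\<not> (\<chi> = \<rho> \<and> map \<nu> (frontier \<rho>) = map \<sigma>_uc (frontier \<rho>))"
        using nobs \<kappa> obsolete_first_trigger F unfolding branch_facts_def by metis
      then have ne: "Fun (FSym \<rho> (hc \<rho>) z) (map \<sigma>_uc (frontier \<rho>)) \<noteq> a" for z
        unfolding 2 by (metis fsym.inject trm.inject(2))
      have sub: "subterms a = insert a (\<Union>x\<in>set (frontier \<chi>). subterms (\<nu> x))" using 2 by simp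
      show ?thesis
        unfolding no_base_terms_def sub using ne no_base[unfolded no_base_terms_def] by simp
    qed (simp add: no_base)
  qed
  moreover have "reach R hc (rule_database \<rho>) (map_atom ?E ` (F \<union> out_hc hc \<kappa>))"
  proof -
    have "trigger_on R (\<chi>, ?E \<circ> \<nu>)"
      using on \<kappa> by (simp add: trigger_on_def unname_sk_terms)
    moreover have "loaded (\<chi>, ?E \<circ> \<nu>) (map_atom ?E ` F)"
      using ld unfolding \<kappa> by (rule loaded_map) simp
    ultimately have "reach R hc (rule_database \<rho>) (map_atom ?E ` F \<union> out_hc hc (\<chi>, ?E \<circ> \<nu>))"
      using F by (intro reach_step) (auto simp: branch_facts_def)
    then show ?thesis by (simp add: image_Un \<kappa> hom_out_hc[OF hom_unname])
  qed
  ultimately show ?thesis using F by (auto simp: branch_facts_def)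
qed

text \<open>By injectivity a loaded trigger can be pulled back to \<open>F\<close>; there it is
  obsolete, and obsolescence is carried forward again by \<open>unname\<close>.\<close>

lemma satisfies_unname:
  assumes F: "branch_facts F" and sat: "satisfies F \<psi>"
  shows "satisfies (map_atom (unname (hc \<rho>) \<rho>) ` F) \<psi>"
  unfolding satisfies_def
proof (intro allI impI)
  fix \<nu>
  let ?E = "unname (hc \<rho>) \<rho>"
  let ?X = "\<Union>A\<in>F. set (args A)"
  let ?e = "inv_into ?X ?E"
  assume ld: "loaded (\<psi>, \<nu>) (map_atom ?E ` F)"
  have "no_base_terms (hc \<rho>) \<rho> a" if "a \<in> ?X" for a
    using that F by (auto simp: branch_facts_def)
  then have "inj_on ?E ?X" using unname_inj[of "hc \<rho>" \<rho>] unfolding inj_on_def by blast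
  then have e: "?e (?E a) = a" if "a \<in> ?X" for a using that by simp
  have "map_atom ?e (map_atom ?E A) = A" if "A \<in> F" for A
    unfolding map_atom_comp using that e by (intro map_atom_fixed) auto
  then have "map_atom ?e ` map_atom ?E ` F \<subseteq> F" by auto
  with ld have "loaded (\<psi>, ?e \<circ> \<nu>) F" by (rule loaded_map)
  then have "obsolete (\<psi>, ?e \<circ> \<nu>) F" using sat by (simp add: satisfies_def)
  then show "obsolete (\<psi>, \<nu>) (map_atom ?E ` F)"
  proof (rule obsolete_map)
    fix x assume "x \<in> set (frontier \<psi>)"
    then obtain A where "A \<in> map_atom ?E ` F" "\<nu> x \<in> set (args A)"
      using loaded_value[OF ld] frontier_subset by blast
    then have "\<nu> x \<in> ?E ` ?X" by fastforce
    then show "?E ((?e \<circ> \<nu>) x) = \<nu> x" by (simp add: f_inv_into_f)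
  qed simp
qed

text \<open>Contrapositive form of choosing the earliest repeating trigger: while all values are
  plain, a further trigger for \<rho> would be repeating, and the other rules introduce no Skolem
  symbols of \<rho>.\<close>

lemma RPC_facts_plain:
  assumes gen: "generating \<rho>" and none: "\<And>\<tau>. \<not> repeating_trigger R hc \<rho> \<tau>"
  shows "A \<in> RPC_facts R hc \<rho> \<Longrightarrow> a \<in> set (args A) \<Longrightarrow> plain \<rho> a"
proof (induction arbitrary: a rule: RPC_facts.induct)
  case (db A)
  then show ?case by (auto simp: rule_database_def inst_def plain_def \<sigma>_uc_def)
next
  case (first A)
  then have "A \<in> out (hc \<rho>) (\<rho>, \<sigma>_uc)" by (simp add: out_hc_def)
  from this hc_less[OF rho] first.prems show ?case
    by (cases rule: args_out_cases) (auto simp: plain_def \<sigma>_uc_def)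
next
  case (step \<psi> \<tau> A)
  have \<psi>: "\<psi> \<in> R" using step.hyps by (simp add: trigger_on_def)
  have \<tau>: "\<tau> x \<in> T" "plain \<rho> (\<tau> x)" if "x \<in> univ_vars \<psi>" for x
    using loaded_value[OF step.IH that] RPC_facts_seeded by blast+
  have "\<psi> \<noteq> \<rho>"
  proof
    assume "\<psi> = \<rho>"
    moreover have "loaded (\<psi>, \<tau>) (RPC_facts R hc \<rho>)" using step.IH by (auto elim!: loaded_subset)
    ultimately have "repeating_trigger R hc \<rho> \<tau>"
      using step.hyps \<tau> not_datalog_generating[OF gen] by unfold_locales auto
    with none show False by blast
  qed
  have "A \<in> out (hc \<psi>) (\<psi>, \<tau>)" using step.hyps by (simp add: out_hc_def)
  from this hc_less[OF \<psi>] step.prems show ?case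
  proof (cases rule: args_out_cases)
    case (1 x)
    then show ?thesis using \<tau> frontier_subset by blast
  next
    case (2 y)
    have "plain \<rho> (\<tau> x)" if "x \<in> set (frontier \<psi>)" for x
      using that \<tau> frontier_subset by blast
    with 2 \<open>\<psi> \<noteq> \<rho>\<close> show ?thesis by (auto simp: plain_def)
  qed
qed

text \<open>In a plain term the arguments of a Skolem symbol of \<rho> are constants, which leaves
  no room for a nested occurrence.\<close>

lemma ex_repeating_trigger:
  assumes "generating \<rho>" "t \<in> terms_of (RPC_facts R hc \<rho>)" "rule_cyclic \<rho> t"
  shows "\<exists>\<tau>. repeating_trigger R hc \<rho> \<tau>"
proof (rule ccontr)
  assume "\<not> ?thesis"
  then obtain a where "plain \<rho> a" "t \<in> subterms a"
    using RPC_facts_plain[OF assms(1)] assms(2) unfolding terms_of_def by blast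
  then have "plain \<rho> t" using subterms_trans unfolding plain_def by blast
  moreover obtain i y ss s where t: "t = Fun (FSym \<rho> i y) ss" "s \<in> set ss" "occurs (FSym \<rho> i y) s"
    using assms(3) by (auto simp: rule_cyclic_def sk_funs_def)
  ultimately have "ss = map \<sigma>_uc (frontier \<rho>)" unfolding plain_def using subterms_refl by blast
  with t show False by (auto simp: occurs_def \<sigma>_uc_def)
qed

text \<open>A finite chase tree would have a leaf whose renamed facts are finite, being reached in
  finitely many steps, and infinite by \<open>infinite_model\<close>.\<close>

lemma never_terminates_if_repeating:
  assumes "repeating_trigger R hc \<rho> \<tau>"
  shows "never_terminates R"
  unfolding never_terminates_def
proof (intro exI[of _ "named_database (hc \<rho>) \<rho>"] conjI notI)
  show "database (named_database (hc \<rho>) \<rho>)" by (rule database_named)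
  interpret repeating_trigger R hc \<rho> \<tau> by (rule assms)
  assume "\<exists>V fct. chase_tree R (named_database (hc \<rho>) \<rho>) V fct \<and> finite V"
  then obtain F where F: "branch_facts F" and sat: "\<forall>\<psi>\<in>R. satisfies F \<psi>"
    using chase_tree_leaf[of R _ _ _ hc branch_facts] branch_facts_named_database
      branch_facts_step hc by blast
  let ?F = "map_atom (unname (hc \<rho>) \<rho>) ` F"
  have reach: "reach R hc (rule_database \<rho>) ?F" using F by (simp add: branch_facts_def)
  have "rule_database \<rho> \<union> out_hc hc (\<rho>, \<sigma>_uc) \<subseteq> ?F"
    unfolding unname_named_database[symmetric] using F by (auto simp: branch_facts_def)
  then have "infinite ?F"
    using reach satisfies_unname[OF F] sat by (intro infinite_model) auto
  moreover have "finite ?F"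
    using reach by (rule reach_finite) (simp add: rule_database_def)
  ultimately show False by blast
qed

end

theorem theorem4:
  fixes R :: "rule set"
  assumes "\<forall>\<rho>\<in>R. wf_rule \<rho>"
    and "restricted_prefix_cyclic R"
  shows "never_terminates R"
proof -
  obtain hc \<rho> t where hc: "head_choice_for R hc" and \<rho>: "\<rho> \<in> R" "generating \<rho>"
    and t: "t \<in> terms_of (RPC_facts R hc \<rho>)" "rule_cyclic \<rho> t"
    using assms(2) unfolding restricted_prefix_cyclic_def by blast
  interpret rule_base R hc \<rho>
    using assms(1) hc \<rho>(1) by unfold_locales auto
  show ?thesis using ex_repeating_trigger[OF \<rho>(2) t] never_terminates_if_repeating by blast
qed

end
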